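(* Let $M=M(S^2;\frac{q_1}{p_1},\frac{q_2}{p_2},\frac{q_3}{p_3})$ be a Seifert manifold with $e(M)\neq0$ which has no exceptional abelian characters. Then the character scheme $\mathcal{X}(M)$ is reduced.
   Context: $M(S^2;\frac{q_1}{p_1},\frac{q_2}{p_2},\frac{q_3}{p_3})$ ($(p_i,q_i)$ coprime, $p_i\ge1$) is the closed Seifert manifold obtained from $S_{0,3}\times S^1$ by gluing solid tori whose meridians are $p_ic_i+q_ih_i$; $e(M)=\sum_iq_i/p_i$; $\pi_1(M)=\langle c_1,c_2,c_3,h\mid [c_i,h]=1=c_i^{p_i}h^{q_i},\ c_1c_2c_3=1\rangle$. $\mathcal{X}(M)=\mathrm{Hom}(\pi_1(M),\mathrm{SL}_2(\mathbb{C}))/\!/\mathrm{SL}_2(\mathbb{C})$ is the character scheme, reduced if its coordinate ring has no nonzero nilpotents. An abelian character is the trace of a diagonal representation; it is exceptional if it is the trace of a representation $\rho$ with $\rho(h)=\pm I$ and $\rho(c_i)\neq\pm I$ for $i=1,2,3$. *)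

theory Defs
  imports Complex_Main "HOL-Library.Poly_Mapping"
begin

datatype 'a m2 = M2 'a 'a 'a 'a  (* M2 a b c d = [[a,b],[c,d]] *)

fun m2_mul :: "'a::comm_ring_1 m2 \<Rightarrow> 'a m2 \<Rightarrow> 'a m2" where
  "m2_mul (M2 a b c d) (M2 a' b' c' d') =
     M2 (a*a' + b*c') (a*b' + b*d') (c*a' + d*c') (c*b' + d*d')"

definition m2_id :: "'a::comm_ring_1 m2" where "m2_id = M2 1 0 0 1"

fun m2_det :: "'a::comm_ring_1 m2 \<Rightarrow> 'a" where "m2_det (M2 a b c d) = a*d - b*c"
fun m2_tr :: "'a::comm_ring_1 m2 \<Rightarrow> 'a" where "m2_tr (M2 a b c d) = a + d"
fun m2_adj :: "'a::comm_ring_1 m2 \<Rightarrow> 'a m2" where "m2_adj (M2 a b c d) = M2 d (-b) (-c) a"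
fun m2_entries :: "'a m2 \<Rightarrow> 'a list" where "m2_entries (M2 a b c d) = [a, b, c, d]"
fun m2_map :: "('a \<Rightarrow> 'b) \<Rightarrow> 'a m2 \<Rightarrow> 'b m2" where
  "m2_map f (M2 a b c d) = M2 (f a) (f b) (f c) (f d)"
fun m2_diagonal :: "'a::zero m2 \<Rightarrow> bool" where "m2_diagonal (M2 a b c d) = (b = 0 \<and> c = 0)"

section \<open>Words in the generators c1, c2, c3, h (indices 0,1,2,3)\<close>

text \<open>A letter (k, False) is generator k, (k, True) its inverse.\<close>
type_synonym word = "(nat \<times> bool) list"

definition gen_h :: nat where "gen_h = 3"

text \<open>Value of a word under an assignment of SL2 matrices to generators
  (inverse = adjugate, valid for determinant-1 matrices / modulo det - 1).\<close>
fun eval_word :: "(nat \<Rightarrow> 'a::comm_ring_1 m2) \<Rightarrow> word \<Rightarrow> 'a m2" where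
  "eval_word \<rho> [] = m2_id"
| "eval_word \<rho> ((k, isinv) # w) = m2_mul (if isinv then m2_adj (\<rho> k) else \<rho> k) (eval_word \<rho> w)"

definition wpow :: "nat \<Rightarrow> int \<Rightarrow> word" where
  "wpow k n = (if n \<ge> 0 then replicate (nat n) (k, False) else replicate (nat (-n)) (k, True))"

text \<open>Relators of
  pi_1(M) = < c1,c2,c3,h | [c_i,h] = 1 = c_i^{p_i} h^{q_i}, c1 c2 c3 = 1 >,
  with (p_i,q_i) = (p (i-1), q (i-1)).\<close>
definition relators :: "(nat \<Rightarrow> int) \<Rightarrow> (nat \<Rightarrow> int) \<Rightarrow> word list" where
  "relators p q =
     [[(i, False), (gen_h, False), (i, True), (gen_h, True)]. i \<leftarrow> [0, 1, 2]] @
     [wpow i (p i) @ wpow gen_h (q i). i \<leftarrow> [0, 1, 2]] @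
     [[(0, False), (1, False), (2, False)]]"

definition is_rep :: "(nat \<Rightarrow> int) \<Rightarrow> (nat \<Rightarrow> int) \<Rightarrow> (nat \<Rightarrow> complex m2) \<Rightarrow> bool" where
  "is_rep p q \<rho> \<longleftrightarrow> (\<forall>k<4. m2_det (\<rho> k) = 1) \<and> (\<forall>r \<in> set (relators p q). eval_word \<rho> r = m2_id)"

definition same_character :: "(nat \<Rightarrow> complex m2) \<Rightarrow> (nat \<Rightarrow> complex m2) \<Rightarrow> bool" where
  "same_character \<rho> \<sigma> \<longleftrightarrow> (\<forall>w. m2_tr (eval_word \<rho> w) = m2_tr (eval_word \<sigma> w))"

definition diagonal_rep :: "(nat \<Rightarrow> complex m2) \<Rightarrow> bool" where
  "diagonal_rep \<rho> \<longleftrightarrow> (\<forall>k<4. m2_diagonal (\<rho> k))"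

definition pm_id :: "complex m2 \<Rightarrow> bool" where
  "pm_id A \<longleftrightarrow> A = m2_id \<or> A = M2 (-1) 0 0 (-1)"

definition has_exceptional_abelian_character :: "(nat \<Rightarrow> int) \<Rightarrow> (nat \<Rightarrow> int) \<Rightarrow> bool" where
  "has_exceptional_abelian_character p q \<longleftrightarrow>
     (\<exists>\<rho>0 \<rho>. is_rep p q \<rho>0 \<and> diagonal_rep \<rho>0 \<and> is_rep p q \<rho> \<and> same_character \<rho>0 \<rho> \<and>
        pm_id (\<rho> gen_h) \<and> (\<forall>i<3. \<not> pm_id (\<rho> i)))"

type_synonym cpoly = "(nat \<Rightarrow>\<^sub>0 nat) \<Rightarrow>\<^sub>0 complex"

definition pconst :: "complex \<Rightarrow> cpoly" where "pconst c = Poly_Mapping.single 0 c"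
definition pvar :: "nat \<Rightarrow> cpoly" where "pvar v = Poly_Mapping.single (Poly_Mapping.single v 1) 1"

definition psubst :: "(nat \<Rightarrow> cpoly) \<Rightarrow> cpoly \<Rightarrow> cpoly" where
  "psubst s f = (\<Sum>mon\<in>Poly_Mapping.keys f. pconst (Poly_Mapping.lookup f mon) * (\<Prod>v\<in>Poly_Mapping.keys (mon :: nat \<Rightarrow>\<^sub>0 nat). s v ^ Poly_Mapping.lookup mon v))"

definition ideal_gen :: "'a::comm_ring_1 set \<Rightarrow> 'a set" where
  "ideal_gen S = {f. \<exists>F c. finite F \<and> F \<subseteq> S \<and> f = (\<Sum>s\<in>F. c s * s)}"

definition Xgen :: "nat \<Rightarrow> cpoly m2" where
  "Xgen k = M2 (pvar (4*k)) (pvar (4*k+1)) (pvar (4*k+2)) (pvar (4*k+3))"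

definition rep_ideal :: "(nat \<Rightarrow> int) \<Rightarrow> (nat \<Rightarrow> int) \<Rightarrow> cpoly set" where
  "rep_ideal p q = ideal_gen
     ({m2_det (Xgen k) - 1 | k. k < 4} \<union>
      {x - y | x y r. r \<in> set (relators p q) \<and>
                (x, y) \<in> set (zip (m2_entries (eval_word Xgen r)) (m2_entries (m2_id :: cpoly m2)))})"

definition poly_in_rep_vars :: "cpoly \<Rightarrow> bool" where
  "poly_in_rep_vars f \<longleftrightarrow> (\<forall>m\<in>Poly_Mapping.keys f. Poly_Mapping.keys m \<subseteq> {..<16})"

text \<open>Action of g in SL2(C) on the coordinate ring by conjugation: the generic matrix X_k
  is replaced by g X_k g^{-1}.\<close>
definition conj_subst :: "complex m2 \<Rightarrow> nat \<Rightarrow> cpoly" where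
  "conj_subst g v = (if v < 16
     then m2_entries (m2_mul (m2_mul (m2_map pconst g) (Xgen (v div 4))) (m2_map pconst (m2_adj g))) ! (v mod 4)
     else pvar v)"

text \<open>f represents an element of the invariant ring C[Hom(pi_1 M, SL2 C)]^{SL2 C}
  = coordinate ring of the character scheme X(M).\<close>
definition invariant_mod :: "cpoly set \<Rightarrow> cpoly \<Rightarrow> bool" where
  "invariant_mod I f \<longleftrightarrow> poly_in_rep_vars f \<and>
     (\<forall>g. m2_det g = 1 \<longrightarrow> psubst (conj_subst g) f - f \<in> I)"

definition character_scheme_reduced :: "(nat \<Rightarrow> int) \<Rightarrow> (nat \<Rightarrow> int) \<Rightarrow> bool" where
  "character_scheme_reduced p q \<longleftrightarrow>
     (\<forall>f. invariant_mod (rep_ideal p q) f \<longrightarrow> (\<exists>n. f ^ n \<in> rep_ideal p q) \<longrightarrow> f \<in> rep_ideal p q)"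

definition euler_number :: "(nat \<Rightarrow> int) \<Rightarrow> (nat \<Rightarrow> int) \<Rightarrow> rat" where
  "euler_number p q = (\<Sum>i<3. of_int (q i) / of_int (p i))"

end

theory Submission
  imports Defs "HOL-Computational_Algebra.Fundamental_Theorem_Algebra"
begin

text \<open>
  Already the representation scheme is reduced. Let \<open>f\<close> be nilpotent but nonzero in its coordinate
  ring. An ideal \<open>J\<close> maximal among the ideals that contain the relations
  but not \<open>f\<close> yields a local ring \<open>L\<close> in which \<open>f\<close> is still nonzero. Over \<open>L\<close> the universal
  representation is conjugate to one with constant complex entries. Hence \<open>f\<close>, which vanishes at
  all complex points, vanishes in \<open>L\<close>, because a polynomial vanishing on a complex conjugation
  orbit vanishes identically along it.

  For the conjugation to a constant representation: if some trace-free coordinate of the fibre \<open>h\<close>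
  is a unit, then everything commutes, and \<open>e \<noteq> 0\<close> makes all generators torsion, hence simultaneously
  diagonalisable with roots of unity as eigenvalues. Otherwise \<open>h = \<plusminus>1\<close> modulo the maximal ideal and
  every \<open>c\<^sub>i\<close> has there roots of unity as eigenvalues. If some \<open>c\<^sub>i\<close> has a double eigenvalue, then
  \<open>c\<^sub>i\<close> is a polynomial in the central element \<open>c\<^sub>i\<^bsup>p\<^sub>i\<^esup>\<close> and again everything commutes. If none has, the
  absence of exceptional abelian characters makes \<open>det [c\<^sub>1, c\<^sub>2]\<close> a unit (Fricke's formula), which forces
  \<open>h = \<plusminus>1\<close> exactly, the traces of the \<open>c\<^sub>i\<close> are constants, and an irreducible triple
  is determined by its traces up to conjugation.
\<close>

section \<open>The ring of 2 by 2 matrices\<close>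

instantiation m2 :: (comm_ring_1) ring_1
begin

definition "0 = M2 0 0 0 (0::'a)"
definition "1 = (m2_id :: 'a m2)"
fun plus_m2 :: "'a m2 \<Rightarrow> 'a m2 \<Rightarrow> 'a m2" where
  "plus_m2 (M2 a b c d) (M2 a' b' c' d') = M2 (a + a') (b + b') (c + c') (d + d')"
fun minus_m2 :: "'a m2 \<Rightarrow> 'a m2 \<Rightarrow> 'a m2" where
  "minus_m2 (M2 a b c d) (M2 a' b' c' d') = M2 (a - a') (b - b') (c - c') (d - d')"
fun uminus_m2 :: "'a m2 \<Rightarrow> 'a m2" where
  "uminus_m2 (M2 a b c d) = M2 (- a) (- b) (- c) (- d)"
definition times_m2 :: "'a m2 \<Rightarrow> 'a m2 \<Rightarrow> 'a m2" where
  "times_m2 = m2_mul"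

instance
proof
  fix x y z :: "'a m2"
  show "x + y + z = x + (y + z)" by (cases x; cases y; cases z) auto
  show "x + y = y + x" by (cases x; cases y) auto
  show "0 + x = x" by (cases x) (auto simp: zero_m2_def)
  show "- x + x = 0" by (cases x) (auto simp: zero_m2_def)
  show "x - y = x + - y" by (cases x; cases y) auto
  show "x * y * z = x * (y * z)"
    by (cases x; cases y; cases z) (auto simp: times_m2_def algebra_simps)
  show "1 * x = x" by (cases x) (auto simp: times_m2_def one_m2_def m2_id_def)
  show "x * 1 = x" by (cases x) (auto simp: times_m2_def one_m2_def m2_id_def)
  show "(x + y) * z = x * z + y * z"
    by (cases x; cases y; cases z) (auto simp: times_m2_def algebra_simps)
  show "x * (y + z) = x * y + x * z"
    by (cases x; cases y; cases z) (auto simp: times_m2_def algebra_simps)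
  show "(0 :: 'a m2) \<noteq> 1" by (auto simp: zero_m2_def one_m2_def m2_id_def)
qed

end

lemma m2_mul_eq_times [simp]: "m2_mul A B = A * B"
  by (simp add: times_m2_def)

lemma m2_id_eq_one [simp]: "m2_id = 1"
  by (simp add: one_m2_def)

lemma m2_times [simp]:
  "M2 a b c d * M2 a' b' c' d' = M2 (a*a' + b*c') (a*b' + b*d') (c*a' + d*c') (c*b' + d*d')"
  by (simp add: times_m2_def del: m2_mul_eq_times)

lemma m2_one: "1 = M2 1 0 0 1"
  unfolding one_m2_def m2_id_def ..

lemma m2_det_1 [simp]: "m2_det 1 = 1" and m2_adj_1 [simp]: "m2_adj 1 = 1"
  by (simp_all add: m2_one)

definition sc :: "'a::comm_ring_1 \<Rightarrow> 'a m2" where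
  "sc a = M2 a 0 0 a"

lemma sc_add: "sc (a + b) = sc a + sc b" and sc_mult: "sc (a * b) = sc a * sc b"
  and sc_diff: "sc (a - b) = sc a - sc b" and sc_uminus: "sc (- a) = - sc a"
  and sc_1: "sc 1 = 1" and sc_0: "sc 0 = 0" and sc_commute: "sc a * X = X * sc a"
  by (cases X; simp add: sc_def m2_one zero_m2_def mult.commute)+

lemma sc_times: "sc a * M2 x y z w = M2 (a * x) (a * y) (a * z) (a * w)"
  by (simp add: sc_def)

lemma sc_power: "sc (a ^ n) = sc a ^ n"
  by (induction n) (simp_all add: sc_1 sc_mult)

lemma m2_det_times: "m2_det (A * B) = m2_det A * m2_det B"
  by (cases A; cases B) (simp add: algebra_simps)

lemma m2_adj_times: "m2_adj (A * B) = m2_adj B * m2_adj A"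
  by (cases A; cases B) (simp add: algebra_simps)

lemma m2_adj_adj: "m2_adj (m2_adj A) = A"
  by (cases A) simp

lemma m2_times_adj: "A * m2_adj A = sc (m2_det A)" "m2_adj A * A = sc (m2_det A)"
  by (cases A; simp add: sc_def algebra_simps)+

lemma m2_adj_inverse:
  assumes "m2_det A = 1"
  shows "A * m2_adj A = 1" "m2_adj A * A = 1"
  using assms by (simp_all add: m2_times_adj sc_1)

lemma m2_tr_commute: "m2_tr (A * B) = m2_tr (B * A)"
  by (cases A; cases B) (simp add: algebra_simps)

lemma cayley_hamilton: "A * A = sc (m2_tr A) * A - sc (m2_det A)"
  by (cases A) (simp add: sc_def algebra_simps)

lemma m2_det_diff_sc:
  "m2_det (A - sc w) = w * w - m2_tr A * w + m2_det A"
  by (cases A) (simp add: sc_def algebra_simps)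

lemma m2_det_prod_list: "m2_det (prod_list As) = prod_list (map m2_det As)"
  by (induction As) (simp_all add: m2_det_times)

lemma m2_adj_power: "m2_adj (A ^ n) = m2_adj A ^ n"
  by (induction n) (simp_all add: m2_adj_times power_commutes)

text \<open>Taking determinants makes \<open>m2_det A\<close> a unit, so \<open>B\<close> is a
  scalar multiple of the adjugate of \<open>A\<close>, which inverts on both sides.\<close>

lemma m2_left_inverse_imp_right:
  fixes A B :: "'a::comm_ring_1 m2"
  assumes "A * B = 1"
  shows "B * A = 1"
proof -
  have d: "m2_det A * m2_det B = 1"
    using assms m2_det_times[of A B] by simp
  have "B = sc (m2_det B) * sc (m2_det A) * B"
    using d by (simp add: sc_mult[symmetric] sc_1 mult.commute)
  also have "\<dots> = sc (m2_det B) * m2_adj A * (A * B)"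
    by (simp add: m2_times_adj(2)[of A, symmetric] mult.assoc)
  finally have "B = sc (m2_det B) * m2_adj A"
    using assms by simp
  hence "B * A = sc (m2_det B) * (m2_adj A * A)"
    by (metis mult.assoc)
  thus ?thesis
    using d by (simp add: m2_times_adj sc_mult[symmetric] sc_1 mult.commute)
qed

section \<open>Factoring powers over the roots of unity\<close>

text \<open>Since \<delta> is nonzero, X^n - \<delta> shares no root with its derivative n X^(n-1),
  so it is the product of its distinct linear factors. The roots form a list because the product is
  later evaluated in a noncommutative ring.\<close>

lemma prod_linear_roots_of_unity:
  fixes \<delta> :: complex
  assumes "n > 0" "\<delta> \<noteq> 0" "distinct ws" "set ws = {w. w ^ n = \<delta>}"
  shows "(\<Prod>w\<leftarrow>ws. [:- w, 1:]) = Polynomial.monom 1 n + [:- \<delta>:]"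
proof -
  define f where "f = Polynomial.monom 1 n + [:- \<delta>:]"
  have poly_f: "poly f z = z ^ n - \<delta>" for z
    by (simp add: f_def poly_monom)
  have roots: "{z. poly f z = 0} = set ws"
    unfolding poly_f assms(4) by auto
  have "rsquarefree f"
    unfolding rsquarefree_roots
  proof (intro allI notI)
    fix a assume a: "poly f a = 0 \<and> poly (pderiv f) a = 0"
    have "pderiv f = Polynomial.monom (of_nat n) (n - 1)"
      by (simp add: f_def pderiv_add pderiv_monom pderiv_pCons)
    hence "of_nat n * a ^ (n - 1) = 0"
      using a by (simp add: poly_monom)
    hence "a = 0"
      using assms(1) by auto
    hence "poly f a = - \<delta>"
      using assms(1) by (simp add: poly_f)
    thus False
      using a assms(2) by simp
  qed
  hence "smult (lead_coeff f) (\<Prod>z | poly f z = 0. [:- z, 1:]) = f"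
    by (rule complex_poly_decompose_rsquarefree)
  moreover have "lead_coeff f = 1"
  proof -
    have "degree f = n"
      unfolding f_def using assms(1) by (subst degree_add_eq_left) (simp_all add: degree_monom_eq)
    moreover have "coeff [:- \<delta>:] n = 0"
      using assms(1) by (cases n) auto
    ultimately show ?thesis by (simp add: f_def)
  qed
  ultimately have "(\<Prod>z\<in>set ws. [:- z, 1:]) = f"
    unfolding roots by simp
  thus ?thesis
    by (simp only: f_def prod.distinct_set_conv_list[OF assms(3)])
qed

text \<open>The target may be noncommutative: the ring of 2 by 2 matrices, with constants embedded
  as scalar matrices, will be an instance.\<close>

locale complex_algebra =
  fixes \<kappa> :: "complex \<Rightarrow> 'b::ring_1"
  assumes hom_add: "\<kappa> (a + b) = \<kappa> a + \<kappa> b"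
    and hom_mult: "\<kappa> (a * b) = \<kappa> a * \<kappa> b"
    and hom_1: "\<kappa> 1 = 1"
begin

lemma hom_0: "\<kappa> 0 = 0"
  using hom_add[of 0 0] by simp

lemma hom_uminus: "\<kappa> (- a) = - \<kappa> a"
  using hom_add[of a "- a"] hom_0 by (simp add: eq_neg_iff_add_eq_0 add.commute)

lemma hom_diff: "\<kappa> (a - b) = \<kappa> a - \<kappa> b"
  using hom_add[of a "- b"] hom_uminus[of b] by simp

lemma hom_power: "\<kappa> (a ^ n) = \<kappa> a ^ n"
  by (induction n) (simp_all add: hom_1 hom_mult)

lemma hom_of_nat: "\<kappa> (of_nat n) = of_nat n"
  by (induction n) (simp_all add: hom_0 hom_1 hom_add)

lemma hom_numeral: "\<kappa> (numeral n) = numeral n"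
  using hom_of_nat[of "numeral n"] by simp

lemma hom_inverse: "z \<noteq> 0 \<Longrightarrow> \<kappa> z * \<kappa> (inverse z) = 1"
  by (simp add: hom_1 flip: hom_mult)

lemma hom_inj: "\<kappa> a = \<kappa> b \<longleftrightarrow> a = b"
proof
  assume "\<kappa> a = \<kappa> b"
  hence "\<kappa> (a - b) = 0" by (simp add: hom_diff)
  thus "a = b" using hom_inverse[of "a - b"] by fastforce
qed simp

context
  fixes x :: 'b
  assumes commutes: "\<kappa> z * x = x * \<kappa> z"
begin

text \<open>Horner evaluation at an element commuting with the constants, which suffices to evaluate
  a product of linear factors one by one.\<close>

definition eval_at :: "complex poly \<Rightarrow> 'b" where
  "eval_at f = fold_coeffs (\<lambda>a r. \<kappa> a + x * r) f 0"

lemma eval_at_0: "eval_at 0 = 0"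
  by (simp add: eval_at_def)

lemma eval_at_pCons: "eval_at (pCons a f) = \<kappa> a + x * eval_at f"
  by (cases "a = 0 \<and> f = 0") (auto simp: eval_at_def hom_0)

lemma eval_at_add: "eval_at (f + g) = eval_at f + eval_at g"
  by (induction f g rule: poly_induct2)
     (simp_all add: eval_at_0 eval_at_pCons hom_add algebra_simps)

lemma eval_at_smult: "eval_at (smult a f) = \<kappa> a * eval_at f"
  by (induction f)
     (simp_all add: eval_at_0 eval_at_pCons hom_mult distrib_left commutes mult.assoc[symmetric])

lemma eval_at_linear_mult: "eval_at ([:- w, 1:] * f) = (x - \<kappa> w) * eval_at f"
proof -
  have "[:- w, 1:] * f = smult (- w) f + pCons 0 f"
    by simp
  thus ?thesis
    by (simp only: eval_at_add eval_at_smult eval_at_pCons hom_0 hom_uminus) (simp add: algebra_simps)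
qed

lemma eval_at_linear_prod:
  "eval_at (\<Prod>w\<leftarrow>ws. [:- w, 1:]) = (\<Prod>w\<leftarrow>ws. x - \<kappa> w)"
  by (induction ws)
     (simp_all add: eval_at_linear_mult del: mult_pCons_left,
      simp add: one_pCons eval_at_pCons eval_at_0 hom_1)

lemma eval_at_monom: "eval_at (Polynomial.monom 1 n) = x ^ n"
  by (induction n)
     (simp_all add: monom_0 monom_Suc eval_at_pCons eval_at_0 hom_0 hom_1)

lemma prod_roots_eq_power_diff:
  assumes "n > 0" "\<delta> \<noteq> 0" "distinct ws" "set ws = {w. w ^ n = \<delta>}"
  shows "(\<Prod>w\<leftarrow>ws. x - \<kappa> w) = x ^ n - \<kappa> \<delta>"
proof -
  have "(\<Prod>w\<leftarrow>ws. [:- w, 1:]) = Polynomial.monom 1 n + [:- \<delta>:]"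
    by (rule prod_linear_roots_of_unity[OF assms])
  hence "(\<Prod>w\<leftarrow>ws. x - \<kappa> w) = eval_at (Polynomial.monom 1 n + [:- \<delta>:])"
    by (metis eval_at_linear_prod)
  thus ?thesis
    by (simp add: eval_at_add eval_at_monom eval_at_pCons eval_at_0 hom_uminus)
qed

end

end

text \<open>For comparing eigenvalues through traces: v + 1/v is the trace of a matrix in SL_2 with
  eigenvalue v.\<close>

lemma sum_inverse_eq_iff:
  fixes v w :: complex
  assumes "v \<noteq> 0" "w \<noteq> 0"
  shows "v + inverse v = w + inverse w \<longleftrightarrow> v = w \<or> v = inverse w"
proof -
  have "v + inverse v = w + inverse w \<longleftrightarrow> (v - w) * (v - inverse w) = 0"
    using assms by (simp add: field_simps)
  thus ?thesis by simp
qed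

section \<open>Local algebras over the complex numbers\<close>

text \<open>Locality in the form that the non-units are closed under addition: \<open>small\<close>
  describes the maximal ideal and \<approx> is congruence modulo it.\<close>

locale local_algebra = complex_algebra \<iota> for \<iota> :: "complex \<Rightarrow> 'a::comm_ring_1" +
  assumes unit_add: "x + y dvd (1::'a) \<Longrightarrow> x dvd 1 \<or> y dvd 1"
begin

definition small :: "'a \<Rightarrow> bool" where
  "small x \<longleftrightarrow> \<not> x dvd 1"

definition near :: "'a \<Rightarrow> 'a \<Rightarrow> bool" (infix "\<approx>" 50) where
  "x \<approx> y \<longleftrightarrow> small (x - y)"

lemma small_0 [simp]: "small 0"
  by (simp add: small_def)

lemma small_add: "small x \<Longrightarrow> small y \<Longrightarrow> small (x + y)"
  using unit_add by (auto simp: small_def)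

lemma small_mult_left: "small x \<Longrightarrow> small (x * y)"
  by (auto simp: small_def intro: dvd_mult_left)

lemma small_mult_right: "small y \<Longrightarrow> small (x * y)"
  by (auto simp: small_def intro: dvd_mult_right)

lemma small_uminus: "small (- x) \<longleftrightarrow> small x"
  by (simp add: small_def)

lemma small_diff: "small x \<Longrightarrow> small y \<Longrightarrow> small (x - y)"
  using small_add[of x "- y"] by (simp add: small_uminus)

lemma small_mult_cases: "small (x * y) \<Longrightarrow> small x \<or> small y"
  unfolding small_def by (metis mult.right_neutral mult_dvd_mono)

lemma small_prod_list: "small (prod_list xs) \<Longrightarrow> \<exists>x\<in>set xs. small x"
proof (induction xs)
  case Nil
  thus ?case by (simp add: small_def)
next
  case (Cons x xs)
  thus ?case using small_mult_cases[of x "prod_list xs"] by auto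
qed

lemma small_iota: "small (\<iota> z) \<longleftrightarrow> z = 0"
proof
  assume "small (\<iota> z)"
  thus "z = 0"
    using hom_inverse[of z] by (metis dvdI small_def)
qed (simp add: hom_0)

lemma not_small_1 [simp]: "\<not> small 1"
  by (simp add: small_def)

lemma unit_cancel: "\<not> small u \<Longrightarrow> u * x = 0 \<Longrightarrow> x = 0"
proof -
  assume "\<not> small u" "u * x = 0"
  then obtain v where "1 = u * v" by (auto simp: small_def dvd_def)
  hence "x = v * (u * x)" by (metis mult.assoc mult.commute mult.right_neutral)
  thus "x = 0" using \<open>u * x = 0\<close> by simp
qed

lemma near_refl [simp]: "x \<approx> x"
  by (simp add: near_def)

lemma near_sym: "x \<approx> y \<Longrightarrow> y \<approx> x"
  using small_uminus[of "x - y"] by (simp add: near_def)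

lemma near_trans [trans]: "x \<approx> y \<Longrightarrow> y \<approx> z \<Longrightarrow> x \<approx> z"
  using small_add[of "x - y" "y - z"] by (simp add: near_def)

lemma near_add: "x \<approx> y \<Longrightarrow> x' \<approx> y' \<Longrightarrow> x + x' \<approx> y + y'"
  using small_add[of "x - y" "x' - y'"] by (simp add: near_def algebra_simps)

lemma near_uminus: "x \<approx> y \<Longrightarrow> - x \<approx> - y"
  using small_uminus[of "x - y"] by (simp add: near_def)

lemma near_diff: "x \<approx> y \<Longrightarrow> x' \<approx> y' \<Longrightarrow> x - x' \<approx> y - y'"
  using near_add[of x y "- x'" "- y'"] by (simp add: near_uminus)

lemma near_mult: "x \<approx> y \<Longrightarrow> x' \<approx> y' \<Longrightarrow> x * x' \<approx> y * y'"
proof -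
  assume "x \<approx> y" "x' \<approx> y'"
  hence "small ((x - y) * x' + y * (x' - y'))"
    unfolding near_def by (intro small_add small_mult_left small_mult_right)
  thus ?thesis by (simp add: near_def algebra_simps)
qed

lemma near_small: "x \<approx> y \<Longrightarrow> small x \<longleftrightarrow> small y"
  using near_sym[of x y] small_add[of "x - y" y] small_add[of "y - x" x]
  by (auto simp: near_def)

lemma near_iota: "\<iota> a \<approx> \<iota> b \<longleftrightarrow> a = b"
  by (simp add: near_def small_iota flip: hom_diff)

fun m2_small :: "'a m2 \<Rightarrow> bool" where
  "m2_small (M2 a b c d) \<longleftrightarrow> small a \<and> small b \<and> small c \<and> small d"

lemma m2_small_times_left: "m2_small A \<Longrightarrow> m2_small (A * B)"
  by (cases A; cases B) (auto intro!: small_add small_mult_left)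

lemma m2_small_times_right: "m2_small B \<Longrightarrow> m2_small (A * B)"
  by (cases A; cases B) (auto intro!: small_add small_mult_right)

lemma m2_small_add: "m2_small A \<Longrightarrow> m2_small B \<Longrightarrow> m2_small (A + B)"
  by (cases A; cases B) (auto intro!: small_add)

lemma m2_small_det: "m2_small A \<Longrightarrow> small (m2_det A)"
  by (cases A) (auto intro!: small_diff small_mult_left)

lemma m2_small_0: "m2_small 0"
  by (simp add: zero_m2_def)

lemma m2_unit_cancel:
  assumes "\<not> small u" "sc u * A = 0"
  shows "A = 0"
  using assms by (cases A) (auto simp: sc_times zero_m2_def dest: unit_cancel)

text \<open>Multiplying by \<open>m2_adj B\<close> on the right leaves a unit multiple of
  \<open>A\<close>.\<close>

lemma m2_det_unit_cancel:
  assumes "\<not> small (m2_det B)" "A * B = 0"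
  shows "A = 0"
proof -
  have "sc (m2_det B) * A = A * B * m2_adj B"
    by (simp add: mult.assoc m2_times_adj sc_commute)
  thus ?thesis using assms m2_unit_cancel by simp
qed

section \<open>Eigenvalues\<close>

text \<open>Makes the factorisation of x^n - \<delta> available for matrices, the roots being
  subtracted as scalar matrices.\<close>

sublocale sc: complex_algebra "\<lambda>z. sc (\<iota> z)"
  by unfold_locales (simp_all add: hom_add hom_mult hom_1 sc_add sc_mult sc_1)

lemma sc_prod_roots_eq_power_diff:
  assumes "n > 0" "\<delta> \<noteq> 0" "distinct ws" "set ws = {w. w ^ n = \<delta>}"
  shows "(\<Prod>w\<leftarrow>ws. A - sc (\<iota> w)) = A ^ n - sc (\<iota> \<delta>)"
  using sc.prod_roots_eq_power_diff[OF _ assms, of A] by (simp add: sc_commute)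

lemma roots_list:
  assumes "n > 0"
  obtains ws where "distinct ws" "set ws = {w :: complex. w ^ n = \<delta>}"
  using finite_distinct_list[OF finite_nth_roots[OF assms, of \<delta>]] by blast

lemma det_diff_sc_iota:
  assumes "m2_det A = 1" "w \<noteq> 0"
  shows "m2_det (A - sc (\<iota> w)) = - \<iota> w * (m2_tr A - \<iota> (w + inverse w))"
proof -
  have "\<iota> w * \<iota> (inverse w) = 1"
    using assms by (intro hom_inverse)
  thus ?thesis
    using assms by (simp add: m2_det_diff_sc hom_add algebra_simps)
qed

lemma small_det_diff_sc_iota:
  assumes "m2_det A = 1" "w \<noteq> 0"
  shows "small (m2_det (A - sc (\<iota> w))) \<longleftrightarrow> m2_tr A \<approx> \<iota> (w + inverse w)"
  unfolding det_diff_sc_iota[OF assms] near_def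
  using assms small_iota[of w] small_mult_cases[of "- \<iota> w"] small_mult_right small_uminus by blast

text \<open>The product of A - w over all n-th roots w of \<delta> has small determinant, so one
  factor has; this supplies a complex eigenvalue modulo the maximal ideal.\<close>

lemma near_eigenvalue:
  assumes "m2_det A = 1" "n > 0" "\<delta> \<noteq> 0" "m2_small (A ^ n - sc (\<iota> \<delta>))"
  obtains w where "w ^ n = \<delta>" "m2_tr A \<approx> \<iota> (w + inverse w)"
proof -
  obtain ws where ws: "distinct ws" "set ws = {w. w ^ n = \<delta>}"
    using roots_list[OF assms(2)] .
  have "small (m2_det (\<Prod>w\<leftarrow>ws. A - sc (\<iota> w)))"
    using sc_prod_roots_eq_power_diff[OF assms(2,3) ws] assms(4) m2_small_det by simp
  then obtain w where "w \<in> set ws" "small (m2_det (A - sc (\<iota> w)))"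
    by (auto simp: m2_det_prod_list dest!: small_prod_list)
  moreover from this have "w \<noteq> 0"
    using assms(2,3) ws(2) by (auto simp: zero_power)
  ultimately show ?thesis
    using that ws(2) small_det_diff_sc_iota[OF assms(1)] by auto
qed

text \<open>Modulo the maximal ideal the trace leaves only v and 1/v as eigenvalues, so the factors
  of all other roots are invertible and can be cancelled.\<close>

lemma not_small_det_prod_list:
  assumes "m2_det A = 1" "v \<noteq> 0" "m2_tr A \<approx> \<iota> (v + inverse v)"
    and "\<And>w. w \<in> set ws \<Longrightarrow> w \<noteq> 0 \<and> w \<noteq> v \<and> w \<noteq> inverse v"
  shows "\<not> small (m2_det (\<Prod>w\<leftarrow>ws. A - sc (\<iota> w)))"
proof
  assume "small (m2_det (\<Prod>w\<leftarrow>ws. A - sc (\<iota> w)))"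
  then obtain w where w: "w \<in> set ws" "small (m2_det (A - sc (\<iota> w)))"
    by (auto simp: m2_det_prod_list dest!: small_prod_list)
  hence "m2_tr A \<approx> \<iota> (w + inverse w)"
    using assms(1,4) small_det_diff_sc_iota by blast
  hence "v + inverse v = w + inverse w"
    using assms(3) near_sym near_trans near_iota by blast
  thus False
    using assms(2,4) w(1) sum_inverse_eq_iff[of w v] by metis
qed

text \<open>The factor of v = 1/v is split off from the vanishing product over all roots; the other
  factors cancel.\<close>

lemma exact_scalar:
  assumes "m2_det A = 1" "n > 0" "A ^ n = sc (\<iota> \<delta>)" "v ^ n = \<delta>" "v\<^sup>2 = 1"
    and "m2_tr A \<approx> \<iota> (v + inverse v)"
  shows "A = sc (\<iota> v)"
proof -
  have v: "v \<noteq> 0" "inverse v = v"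
    using assms(5) by (auto simp: power2_eq_square inverse_unique)
  hence \<delta>: "\<delta> \<noteq> 0" using assms(4) by auto
  obtain us where us: "distinct us" "set us = {w. w ^ n = \<delta>} - {v}"
    using finite_distinct_list finite_nth_roots[OF assms(2), of \<delta>] by (metis finite_Diff)
  have "set (v # us) = {w. w ^ n = \<delta>}" "distinct (v # us)"
    using us assms(4) by auto
  from sc_prod_roots_eq_power_diff[OF assms(2) \<delta> this(2,1), of A]
  have "(\<Prod>w\<leftarrow>v # us. A - sc (\<iota> w)) = 0"
    using assms(3) by simp
  moreover have "w \<noteq> 0 \<and> w \<noteq> v \<and> w \<noteq> inverse v" if "w \<in> set us" for w
  proof -
    have "w ^ n = \<delta>" "w \<noteq> v"
      using that unfolding us(2) by blast+
    thus ?thesis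
      unfolding v(2) using \<delta> zero_power[OF assms(2)] by metis
  qed
  note not_small_det_prod_list[OF assms(1) v(1) assms(6) this]
  ultimately show ?thesis
    using m2_det_unit_cancel by (metis (no_types, lifting) eq_iff_diff_eq_0 list.simps(9) prod_list.Cons)
qed

text \<open>As \<delta> is its own inverse, v and 1/v are both roots. By Cayley-Hamilton their two
  factors multiply to the trace error times A; cancelling the other factors and then A leaves the
  error zero.\<close>

lemma exact_trace:
  assumes "m2_det A = 1" "n > 0" "A ^ n = sc (\<iota> \<delta>)" "\<delta>\<^sup>2 = 1" "v ^ n = \<delta>" "v\<^sup>2 \<noteq> 1"
    and "m2_tr A \<approx> \<iota> (v + inverse v)"
  shows "m2_tr A = \<iota> (v + inverse v)"
proof -
  have \<delta>: "\<delta> \<noteq> 0" "inverse \<delta> = \<delta>"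
    using assms(4) by (auto simp: power2_eq_square inverse_unique)
  have v: "v \<noteq> 0" "inverse v \<noteq> v"
    using assms(2,5,6) \<delta> by (auto simp: zero_power power2_eq_square field_simps)
  obtain us where us: "distinct us" "set us = {w. w ^ n = \<delta>} - {v, inverse v}"
    using finite_distinct_list finite_nth_roots[OF assms(2), of \<delta>] by (metis finite_Diff)
  let ?B = "\<Prod>w\<leftarrow>us. A - sc (\<iota> w)"
  have inv: "\<iota> v * \<iota> (inverse v) = 1"
    by (rule hom_inverse[OF v(1)])
  have "(A - sc (\<iota> v)) * (A - sc (\<iota> (inverse v)))
      = A * A - sc (\<iota> v + \<iota> (inverse v)) * A + sc (\<iota> v * \<iota> (inverse v))"
    by (simp add: algebra_simps sc_add sc_mult sc_commute[of _ A])
  also have "\<dots> = sc (m2_tr A - \<iota> (v + inverse v)) * A"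
    unfolding inv cayley_hamilton assms(1) by (simp add: hom_add sc_diff algebra_simps)
  finally have eq: "(A - sc (\<iota> v)) * (A - sc (\<iota> (inverse v))) = sc (m2_tr A - \<iota> (v + inverse v)) * A" .
  have "inverse v ^ n = \<delta>"
    using assms(5) \<delta>(2) by (simp add: power_inverse)
  hence "set (v # inverse v # us) = {w. w ^ n = \<delta>}" "distinct (v # inverse v # us)"
    using us assms(5) v(2) by auto
  from sc_prod_roots_eq_power_diff[OF assms(2) \<delta>(1) this(2,1), of A]
  have "(\<Prod>w\<leftarrow>v # inverse v # us. A - sc (\<iota> w)) = 0"
    using assms(3) by simp
  hence "sc (m2_tr A - \<iota> (v + inverse v)) * A * ?B = 0"
    by (simp add: eq mult.assoc[symmetric])
  moreover have "w \<noteq> 0 \<and> w \<noteq> v \<and> w \<noteq> inverse v" if "w \<in> set us" for w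
  proof -
    have "w ^ n = \<delta>" "w \<noteq> v" "w \<noteq> inverse v"
      using that unfolding us(2) by blast+
    thus ?thesis
      using \<delta>(1) zero_power[OF assms(2)] by metis
  qed
  note not_small_det_prod_list[OF assms(1) v(1) assms(7) this]
  ultimately have "sc (m2_tr A - \<iota> (v + inverse v)) * A = 0"
    using m2_det_unit_cancel by blast
  hence "sc (m2_tr A - \<iota> (v + inverse v)) = 0"
    by (rule m2_det_unit_cancel[rotated]) (simp add: assms(1))
  thus ?thesis
    by (simp add: sc_def zero_m2_def)
qed

text \<open>The complex n-th roots of unity stay distinct modulo the maximal ideal, so
  \<open>a\<close> is congruent to just one of them; the other factors of a^n - 1 are units and
  cancel.\<close>

lemma root_of_unity_constant:
  assumes "n > 0" "a ^ n = 1"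
  obtains w where "a = \<iota> w"
proof -
  obtain ws where ws: "distinct ws" "set ws = {w :: complex. w ^ n = 1}"
    using roots_list[OF assms(1)] .
  have prod: "(\<Prod>w\<leftarrow>ws. a - \<iota> w) = 0"
    using prod_roots_eq_power_diff[of a n 1 ws] assms ws by (simp add: hom_1 mult.commute)
  then obtain v where v: "v \<in> set ws" "small (a - \<iota> v)"
    using small_prod_list[of "map (\<lambda>w. a - \<iota> w) ws"] by auto
  obtain us where us: "distinct us" "set us = set ws - {v}"
    using finite_distinct_list by (metis finite_Diff finite_set)
  have "set (v # us) = {w. w ^ n = 1}" "distinct (v # us)"
    using us ws(2) v(1) by auto
  from prod_roots_eq_power_diff[OF mult.commute assms(1) _ this(2,1), of a]
  have "(\<Prod>w\<leftarrow>v # us. a - \<iota> w) = 0"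
    using assms by (simp add: hom_1)
  moreover have "\<not> small (\<Prod>w\<leftarrow>us. a - \<iota> w)"
  proof
    assume "small (\<Prod>w\<leftarrow>us. a - \<iota> w)"
    then obtain w where "w \<in> set us" "a \<approx> \<iota> w"
      using small_prod_list[of "map (\<lambda>w. a - \<iota> w) us"] by (auto simp: near_def)
    moreover have "a \<approx> \<iota> v" using v by (simp add: near_def)
    ultimately show False
      using us near_iota near_sym near_trans by (metis DiffD2 insertI1)
  qed
  ultimately have "a - \<iota> v = 0"
    using unit_cancel[of "\<Prod>w\<leftarrow>us. a - \<iota> w" "a - \<iota> v"] by (simp add: mult.commute)
  thus ?thesis using that by simp
qed

text \<open>By Cayley-Hamilton the columns of A - 1/w and A - w are eigenvectors for w and 1/w. Each
  of the two choices of \<open>G\<close> consists of such columns, up to sign.\<close>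

lemma diagonalise:
  assumes "m2_det A = 1" "m2_tr A = \<iota> (w + inverse w)" "w \<noteq> 0" "w\<^sup>2 \<noteq> 1"
  obtains G where "\<not> small (m2_det G)" "A * G = G * M2 (\<iota> w) 0 0 (\<iota> (inverse w))"
proof -
  obtain a b c d where A: "A = M2 a b c d" by (cases A)
  define u v where "u = \<iota> w" and "v = \<iota> (inverse w)"
  have uv: "u * v = 1" unfolding u_def v_def by (rule hom_inverse[OF assms(3)])
  have d: "d = u + v - a"
    using assms(2) by (simp add: A u_def v_def hom_add algebra_simps)
  have bc: "b * c = a * (u + v - a) - 1"
    using assms(1) by (simp add: A d algebra_simps)
  have "u - v = \<iota> (w - inverse w)" by (simp add: u_def v_def hom_diff)
  moreover have "w - inverse w \<noteq> 0"
    using assms(3,4) by (auto simp: field_simps power2_eq_square)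
  ultimately have unit: "\<not> small (u - v)" by (simp add: small_iota)
  \<comment> \<open>By locality one summand is a unit; it decides which pair of columns stays
    independent modulo the maximal ideal.\<close>
  have "u - v = (a - v) + (u - a)" by simp
  hence "\<not> small (a - v) \<or> \<not> small (u - a)"
    using unit small_add by metis
  thus ?thesis
  proof
    assume *: "\<not> small (a - v)"
    have "m2_det (M2 (a - v) (- b) c (a - v)) = (u - v) * (a - v)"
      using bc uv by (simp add: algebra_simps)
    hence "\<not> small (m2_det (M2 (a - v) (- b) c (a - v)))"
      using * unit small_mult_cases by metis
    moreover have "A * M2 (a - v) (- b) c (a - v) = M2 (a - v) (- b) c (a - v) * M2 u 0 0 v"
      using bc uv by (simp add: A d algebra_simps)
    ultimately show ?thesis using that u_def v_def by blast
  next
    assume *: "\<not> small (u - a)"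
    have "m2_det (M2 b (u - a) (u - a) (- c)) = - ((u - v) * (u - a))"
      using bc uv by (simp add: algebra_simps)
    hence "\<not> small (m2_det (M2 b (u - a) (u - a) (- c)))"
      using * unit small_mult_cases small_uminus by metis
    moreover have "A * M2 b (u - a) (u - a) (- c) = M2 b (u - a) (u - a) (- c) * M2 u 0 0 v"
      using bc uv by (simp add: A d algebra_simps)
    ultimately show ?thesis using that u_def v_def by blast
  qed
qed

text \<open>Modulo the maximal ideal the matrix has the double eigenvalue \<open>w = \<plusminus>1\<close>,
  whence the coefficient \<open>(n + 1) w\<^sup>n\<close>, the derivative of the power map at \<open>w\<close>.\<close>
lemma power_near_double_eigenvalue:
  assumes "m2_det A = 1" "m2_tr A \<approx> \<iota> (w + inverse w)" "w\<^sup>2 = 1"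
  shows "\<exists>\<alpha> \<beta>. A ^ Suc n = sc \<alpha> * A + sc \<beta> \<and> \<alpha> \<approx> \<iota> (of_nat (Suc n) * w ^ n)
    \<and> \<beta> \<approx> \<iota> (- of_nat n * w ^ Suc n)"
proof (induction n)
  case 0
  show ?case
    by (intro exI[of _ 1] exI[of _ 0]) (simp add: sc_1 sc_0 hom_0 hom_1)
next
  case (Suc n)
  then obtain \<alpha> \<beta> where IH: "A ^ Suc n = sc \<alpha> * A + sc \<beta>"
    "\<alpha> \<approx> \<iota> (of_nat (Suc n) * w ^ n)" "\<beta> \<approx> \<iota> (- of_nat n * w ^ Suc n)" by blast
  have inv: "inverse w = w"
    using assms(3) by (intro inverse_unique) (simp add: power2_eq_square)
  have "A ^ Suc (Suc n) = (sc \<alpha> * A + sc \<beta>) * A"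
    by (subst power_Suc2) (simp only: IH(1))
  also have "\<dots> = sc \<alpha> * (A * A) + sc \<beta> * A"
    by (simp add: algebra_simps)
  also have "\<dots> = sc (\<alpha> * m2_tr A + \<beta>) * A + sc (- \<alpha>)"
    unfolding cayley_hamilton assms(1) by (simp add: algebra_simps sc_mult sc_add sc_1 sc_uminus)
  finally have "A ^ Suc (Suc n) = sc (\<alpha> * m2_tr A + \<beta>) * A + sc (- \<alpha>)" .
  moreover have "\<alpha> * m2_tr A + \<beta> \<approx> \<iota> (of_nat (Suc n) * w ^ n) * \<iota> (w + inverse w) + \<iota> (- of_nat n * w ^ Suc n)"
    by (intro near_add near_mult IH assms(2))
  hence "\<alpha> * m2_tr A + \<beta> \<approx> \<iota> (of_nat (Suc (Suc n)) * w ^ Suc n)"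
    by (simp add: inv algebra_simps flip: hom_mult hom_add)
  moreover have "- \<alpha> \<approx> \<iota> (- of_nat (Suc n) * w ^ Suc (Suc n))"
  proof -
    have "w ^ Suc (Suc n) = w ^ n"
      using assms(3) by (simp add: power2_eq_square flip: mult.assoc)
    moreover have "- \<alpha> \<approx> - \<iota> (of_nat (Suc n) * w ^ n)"
      by (intro near_uminus IH)
    ultimately show ?thesis
      by (simp only: hom_uminus[symmetric] mult_minus_left)
  qed
  ultimately show ?case by blast
qed

end

section \<open>Representations of the Seifert group over a local algebra\<close>

text \<open>The adjugate stands in for the inverse, as in \<open>eval_word\<close>.\<close>

definition zpow :: "'a::comm_ring_1 m2 \<Rightarrow> int \<Rightarrow> 'a m2" where
  "zpow A n = (if n \<ge> 0 then A ^ nat n else m2_adj A ^ nat (- n))"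

text \<open>For x, y, z the traces of A, B, AB in SL_2 this is 2 minus the trace of the group
  commutator; over the complex numbers it vanishes exactly on reducible pairs.\<close>

definition fricke :: "'a::comm_ring_1 \<Rightarrow> 'a \<Rightarrow> 'a \<Rightarrow> 'a" where
  "fricke x y z = 4 + x * y * z - x * x - y * y - z * z"

lemma det_commutator:
  fixes A B :: "'a::comm_ring_1 m2"
  assumes "m2_det A = 1" "m2_det B = 1"
  shows "m2_det (A * B - B * A) = fricke (m2_tr A) (m2_tr B) (m2_tr (A * B))"
proof -
  obtain a b c d where A: "A = M2 a b c d" by (cases A)
  obtain a' b' c' d' where B: "B = M2 a' b' c' d'" by (cases B)
  \<comment> \<open>Inserting the determinants makes the formula homogeneous, hence an identity in
    the eight entries.\<close>
  have "m2_det (A * B - B * A) = 4 * (m2_det A * m2_det B)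
      + m2_tr A * m2_tr B * m2_tr (A * B) - m2_tr A * m2_tr A * m2_det B
      - m2_tr B * m2_tr B * m2_det A - m2_tr (A * B) * m2_tr (A * B)"
    by (simp add: A B algebra_simps)
  thus ?thesis
    by (simp add: assms fricke_def)
qed

text \<open>A noncentral element of \<open>SL\<^sub>2\<close> over a field has abelian centraliser. In coordinates: the
  trace-free parts of two matrices commuting with \<open>H\<close> are parallel to that of \<open>H\<close>.\<close>
lemma commutator_annihilated:
  fixes A B :: "'a::comm_ring_1 m2"
  assumes "A * M2 x y z w = M2 x y z w * A" "B * M2 x y z w = M2 x y z w * B"
    and "t \<in> {y, z, x - w}"
  shows "sc t * (A * B - B * A) = 0"
proof -
  obtain a b c d where A: "A = M2 a b c d" by (cases A)
  obtain a' b' c' d' where B: "B = M2 a' b' c' d'" by (cases B)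
  have parallel: "\<beta> * z = y * \<gamma>" "(\<alpha> - \<delta>) * y = \<beta> * (x - w)" "\<gamma> * (x - w) = z * (\<alpha> - \<delta>)"
    if "M2 \<alpha> \<beta> \<gamma> \<delta> * M2 x y z w = M2 x y z w * M2 \<alpha> \<beta> \<gamma> \<delta>" for \<alpha> \<beta> \<gamma> \<delta>
  proof -
    have e: "\<alpha> * x + \<beta> * z = x * \<alpha> + y * \<gamma>" "\<alpha> * y + \<beta> * w = x * \<beta> + y * \<delta>"
      "\<gamma> * x + \<delta> * z = z * \<alpha> + w * \<gamma>"
      using that by simp_all
    show "\<beta> * z = y * \<gamma>"
      using e(1) by (simp add: mult.commute[of x \<alpha>])
    have "(\<alpha> - \<delta>) * y - \<beta> * (x - w) = (\<alpha> * y + \<beta> * w) - (x * \<beta> + y * \<delta>)"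
      by (simp add: algebra_simps)
    thus "(\<alpha> - \<delta>) * y = \<beta> * (x - w)"
      unfolding e(2) by simp
    have "\<gamma> * (x - w) - z * (\<alpha> - \<delta>) = (\<gamma> * x + \<delta> * z) - (z * \<alpha> + w * \<gamma>)"
      by (simp add: algebra_simps)
    thus "\<gamma> * (x - w) = z * (\<alpha> - \<delta>)"
      unfolding e(3) by simp
  qed
  note A' = parallel[OF assms(1)[unfolded A]] and B' = parallel[OF assms(2)[unfolded B]]
  \<comment> \<open>If r and s are parallel to t, the pivot coordinate of t annihilates their minor;
    the index 3 marks the pivot.\<close>
  have cross: "t\<^sub>3 * (r\<^sub>1 * s\<^sub>2 - r\<^sub>2 * s\<^sub>1) = 0"
    if "r\<^sub>3 * t\<^sub>1 = r\<^sub>1 * t\<^sub>3" "s\<^sub>1 * t\<^sub>2 = s\<^sub>2 * t\<^sub>1" "r\<^sub>3 * t\<^sub>2 = r\<^sub>2 * t\<^sub>3"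
    for r\<^sub>1 r\<^sub>2 r\<^sub>3 s\<^sub>1 s\<^sub>2 t\<^sub>1 t\<^sub>2 t\<^sub>3 :: 'a
  proof -
    have "t\<^sub>3 * (r\<^sub>1 * s\<^sub>2) = r\<^sub>3 * (s\<^sub>2 * t\<^sub>1)"
      using that(1) by (metis mult.assoc mult.commute)
    also have "\<dots> = t\<^sub>3 * (r\<^sub>2 * s\<^sub>1)"
      using that(2,3) by (metis mult.assoc mult.commute)
    finally show ?thesis by (simp add: right_diff_distrib)
  qed
  \<comment> \<open>The coordinate of \<open>A\<close> in the position of \<open>t\<close> scales
    the trace-free part of the fixed matrix to \<open>t\<close> times that of
    \<open>A\<close>.\<close>
  have "\<exists>r. r * y = b * t \<and> r * z = c * t \<and> r * (x - w) = (a - d) * t"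
  proof -
    consider "t = y" | "t = z" | "t = x - w"
      using assms(3) by blast
    thus ?thesis
    proof cases
      case 1
      with A' show ?thesis by (intro exI[of _ b]) (simp add: mult.commute)
    next
      case 2
      with A' show ?thesis by (intro exI[of _ c]) (simp add: mult.commute)
    next
      case 3
      with A' show ?thesis by (intro exI[of _ "a - d"]) (simp add: mult.commute)
    qed
  qed
  then obtain r where r: "r * y = b * t" "r * z = c * t" "r * (x - w) = (a - d) * t"
    by blast
  have "t * (b * c' - c * b') = 0"
    by (rule cross[OF r(1) _ r(2)]) (use B'(1) in \<open>simp add: mult.commute\<close>)
  moreover have "t * ((a - d) * b' - b * (a' - d')) = 0"
    by (rule cross[OF r(3) B'(2) r(1)])
  moreover have "t * (c * (a' - d') - (a - d) * c') = 0"
    by (rule cross[OF r(2) _ r(3)]) (use B'(3) in \<open>simp add: mult.commute\<close>)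
  ultimately show ?thesis
    by (simp add: A B sc_def zero_m2_def algebra_simps)
qed

section \<open>Integer powers of matrices of determinant one\<close>

lemma zpow_commute:
  fixes A B :: "'a::comm_ring_1 m2"
  assumes "A * B = B * A"
  shows "A * zpow B n = zpow B n * A"
proof -
  \<comment> \<open>The adjugate is a polynomial in \<open>B\<close>, hence commutes with whatever
    commutes with \<open>B\<close>.\<close>
  have adj: "m2_adj B = sc (m2_tr B) - B"
    by (cases B) (simp add: sc_def)
  have "A * m2_adj B = m2_adj B * A"
    unfolding adj right_diff_distrib left_diff_distrib using assms sc_commute by metis
  thus ?thesis
    using assms power_commuting_commutes[of B A] power_commuting_commutes[of "m2_adj B" A]
    by (simp add: zpow_def)
qed

lemma zpow_add_1:
  fixes A :: "'a::comm_ring_1 m2"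
  assumes "m2_det A = 1"
  shows "zpow A (n + 1) = zpow A n * A"
proof (cases "n \<ge> 0")
  case True
  thus ?thesis by (simp add: zpow_def nat_add_distrib power_commutes)
next
  case False
  then obtain k where k: "n = - int (Suc k)"
    by (metis int_cases not_le of_nat_less_0_iff)
  have "m2_adj A ^ Suc k * A = m2_adj A ^ k"
    using m2_adj_inverse[OF assms] by (simp only: power_Suc2 mult.assoc mult_1_right)
  thus ?thesis by (cases k) (simp_all add: zpow_def k nat_add_distrib)
qed

lemma zpow_add:
  fixes A :: "'a::comm_ring_1 m2"
  assumes "m2_det A = 1"
  shows "zpow A (m + n) = zpow A m * zpow A n"
proof (induction n rule: int_induct[where k = 0])
  case base
  show ?case by (simp add: zpow_def)
next
  case (step1 i)
  thus ?case
    using zpow_add_1[OF assms, of "m + i"] zpow_add_1[OF assms, of i]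
    by (simp add: mult.assoc add.assoc)
next
  case (step2 i)
  have pred: "zpow A (j - 1) = zpow A j * m2_adj A" for j
    using zpow_add_1[OF assms, of "j - 1"] m2_adj_inverse[OF assms] by (simp add: mult.assoc)
  show ?case
    using step2 pred[of "m + i"] pred[of i] by (simp add: mult.assoc add_diff_eq)
qed

lemma zpow_mult_nat:
  fixes A :: "'a::comm_ring_1 m2"
  assumes "m2_det A = 1"
  shows "zpow A (m * int k) = zpow A m ^ k"
proof (induction k)
  case (Suc k)
  thus ?case
    using zpow_add[OF assms, of m "m * int k"] by (simp add: algebra_simps)
qed (simp add: zpow_def)

lemma zpow_eq_1_imp_power:
  fixes A :: "'a::comm_ring_1 m2"
  assumes "zpow A n = 1"
  shows "A ^ nat \<bar>n\<bar> = 1"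
proof (cases "n \<ge> 0")
  case False
  hence "m2_adj (m2_adj A ^ nat \<bar>n\<bar>) = 1"
    using assms by (simp add: zpow_def)
  thus ?thesis by (simp add: m2_adj_power m2_adj_adj)
qed (use assms in \<open>simp add: zpow_def\<close>)

lemma power_1_imp_zpow:
  fixes A :: "'a::comm_ring_1 m2"
  assumes "A ^ k = 1"
  shows "zpow A n ^ k = 1"
proof -
  have "m2_adj A ^ k = 1"
    using assms by (metis m2_adj_1 m2_adj_power)
  thus ?thesis
    using assms by (simp add: zpow_def power_mult[symmetric] mult.commute[of _ k])
      (simp add: power_mult)
qed

lemma power_mult_distrib_commuting:
  fixes x y :: "'a::monoid_mult"
  assumes "x * y = y * x"
  shows "(x * y) ^ n = x ^ n * y ^ n"
proof (induction n)
  case (Suc n)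
  have "(x * y) ^ Suc n = x * (y * x ^ n) * y ^ n"
    by (simp add: Suc mult.assoc)
  also have "y * x ^ n = x ^ n * y"
    using assms by (metis power_commuting_commutes)
  finally show ?case by (simp add: mult.assoc)
qed simp

lemma commute_of_central_product:
  fixes A B :: "'a::comm_ring_1 m2"
  assumes "m2_det A = 1" "A * (A * B) = A * B * A"
  shows "A * B = B * A"
proof -
  have "m2_adj A * (A * (A * B)) = m2_adj A * (A * (B * A))"
    using assms(2) by (simp add: mult.assoc)
  thus ?thesis
    using m2_adj_inverse[OF assms(1)] by (metis mult.assoc mult_1_left)
qed

section \<open>Commuting torsion matrices\<close>

context local_algebra
begin

definition conj_constant :: "(nat \<Rightarrow> 'a m2) \<Rightarrow> bool" where
  "conj_constant X \<longleftrightarrow>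
     (\<exists>G D. \<not> small (m2_det G) \<and> (\<forall>k<4. X k * G = G * m2_map \<iota> (D k)))"

lemma unit_det_inverse:
  assumes "\<not> small (m2_det G)"
  obtains G' where "G * G' = 1" "G' * G = 1"
proof -
  obtain u where u: "1 = m2_det G * u"
    using assms by (auto simp: small_def dvd_def)
  have "G * (sc u * m2_adj G) = 1"
    by (metis m2_times_adj(1) mult.assoc mult.commute sc_1 sc_commute sc_mult u)
  thus ?thesis
    using that m2_left_inverse_imp_right by blast
qed

text \<open>Modulo the maximal ideal every matrix has a root of unity as eigenvalue. If all of these
  are \<plusminus>1, the matrices are scalars; otherwise one is diagonalised with distinct
  eigenvalues, and the others, commuting with it, become diagonal too.\<close>

lemma commuting_torsion_conj_constant:
  assumes det: "\<And>k. k < 4 \<Longrightarrow> m2_det (X k) = 1"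
    and torsion: "n > 0" "\<And>k. k < 4 \<Longrightarrow> X k ^ n = 1"
    and comm: "\<And>j k. j < 4 \<Longrightarrow> k < 4 \<Longrightarrow> X j * X k = X k * X j"
  shows "conj_constant X"
proof -
  have torsion': "X k ^ n = sc (\<iota> 1)" if "k < 4" for k
    using torsion(2)[OF that] by (simp add: hom_1 sc_1)
  have "\<exists>w. w ^ n = 1 \<and> m2_tr (X k) \<approx> \<iota> (w + inverse w)" if "k < 4" for k
  proof -
    have "m2_small (X k ^ n - sc (\<iota> 1))"
      using torsion'[OF that] m2_small_0 by simp
    thus ?thesis
      using near_eigenvalue[OF det[OF that] torsion(1)] by (metis zero_neq_one)
  qed
  then obtain w where w: "\<And>k. k < 4 \<Longrightarrow> w k ^ n = 1 \<and> m2_tr (X k) \<approx> \<iota> (w k + inverse (w k))"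
    by metis
  show ?thesis
  proof (cases "\<exists>k<4. (w k)\<^sup>2 \<noteq> 1")
    case False
    hence "X k = sc (\<iota> (w k))" if "k < 4" for k
      using exact_scalar[OF det[OF that] torsion(1) torsion'[OF that]] w that by blast
    hence "\<not> small (m2_det 1) \<and> (\<forall>k<4. X k * 1 = 1 * m2_map \<iota> (sc (w k)))"
      by (simp add: sc_def hom_0)
    thus ?thesis
      unfolding conj_constant_def by (intro exI[of _ 1] exI[of _ "\<lambda>k. sc (w k)"])
  next
    case True
    then obtain k where k: "k < 4" "(w k)\<^sup>2 \<noteq> 1" by blast
    have wk: "w k \<noteq> 0"
      using w[OF k(1)] torsion(1) by (metis zero_neq_one zero_power)
    have "m2_tr (X k) = \<iota> (w k + inverse (w k))"
      using exact_trace[OF det[OF k(1)] torsion(1) torsion'[OF k(1)]] w k by simp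
    then obtain G where G: "\<not> small (m2_det G)"
      "X k * G = G * M2 (\<iota> (w k)) 0 0 (\<iota> (inverse (w k)))"
      using diagonalise[OF det[OF k(1)] _ wk k(2)] by blast
    obtain G' where G': "G * G' = 1" "G' * G = 1"
      using unit_det_inverse[OF G(1)] .
    have "\<exists>D. X j * G = G * m2_map \<iota> D" if j: "j < 4" for j
    proof -
      define Y where "Y = G' * X j * G"
      define \<Delta> where "\<Delta> = M2 (\<iota> (w k)) 0 0 (\<iota> (inverse (w k)))"
      have Y: "X j * G = G * Y"
        by (simp add: Y_def mult.assoc[symmetric] G')
      have \<Delta>: "\<Delta> = G' * X k * G"
        by (metis G'(2) G(2) \<Delta>_def mult.assoc mult_1_left)
      have "Y * \<Delta> = G' * (X j * (G * G') * X k) * G" "\<Delta> * Y = G' * (X k * (G * G') * X j) * G"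
        unfolding Y_def \<Delta> by (simp_all only: mult.assoc)
      hence "Y * \<Delta> = \<Delta> * Y"
        using comm[OF j k(1)] by (simp add: G')
      moreover obtain a b c d where Yc: "Y = M2 a b c d" by (cases Y)
      \<comment> \<open>Commuting with \<Delta>, whose diagonal entries differ by a unit, kills the
        off-diagonal entries of \<open>Y\<close>.\<close>
      ultimately have "(\<iota> (w k) - \<iota> (inverse (w k))) * b = 0" "(\<iota> (w k) - \<iota> (inverse (w k))) * c = 0"
        by (simp_all add: \<Delta>_def algebra_simps)
      moreover have "\<not> small (\<iota> (w k) - \<iota> (inverse (w k)))"
        using wk k(2) by (simp add: small_iota power2_eq_square field_simps flip: hom_diff)
      ultimately have bc: "b = 0" "c = 0"
        using unit_cancel by blast+
      \<comment> \<open>\<open>Y\<close> inherits the torsion of \<open>X j\<close>, so its diagonal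
        entries are roots of unity in the local ring, and these are constants.\<close>
      have "Y ^ m = G' * X j ^ m * G" for m
      proof (induction m)
        case (Suc m)
        have "Y ^ Suc m = G' * X j * (G * G') * X j ^ m * G"
          by (simp only: power_Suc Suc) (simp only: Y_def mult.assoc)
        thus ?case by (simp add: G' mult.assoc)
      qed (simp add: G')
      hence "Y ^ n = 1" using torsion(2)[OF j] by (simp add: G')
      moreover have "Y ^ m = M2 (a ^ m) 0 0 (d ^ m)" for m
        by (induction m) (simp_all add: Yc bc m2_one)
      ultimately have "a ^ n = 1" "d ^ n = 1"
        by (simp_all add: m2_one)
      then obtain \<alpha> \<delta> where "a = \<iota> \<alpha>" "d = \<iota> \<delta>"
        using root_of_unity_constant[OF torsion(1)] by metis
      hence "Y = m2_map \<iota> (M2 \<alpha> 0 0 \<delta>)"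
        by (simp add: Yc bc hom_0)
      thus ?thesis using Y by blast
    qed
    thus ?thesis
      unfolding conj_constant_def using G(1) by metis
  qed
qed

end

section \<open>Conjugating a Seifert representation to a constant one\<close>

lemma left_inverse_eq_right_inverse:
  fixes x :: "'b::monoid_mult"
  assumes "x * y = 1" "y * z = 1"
  shows "x = z"
proof -
  have "x * (y * z) = x * y * z" by (rule mult.assoc[symmetric])
  thus ?thesis by (simp add: assms)
qed

lemma eq_adj_of_inverse: "m2_det A = 1 \<Longrightarrow> B * A = 1 \<Longrightarrow> B = m2_adj A"
  using left_inverse_eq_right_inverse m2_adj_inverse(1) by metis

text \<open>\<open>euler\<close> is e(M) with denominators cleared. \<open>nonexceptional\<close>
  restates the absence of exceptional abelian characters: with h = \<epsilon> and eigenvalues w i of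
  the generators other than \<plusminus>1, the traces are never those of a reducible triple.\<close>

locale seifert_rep = local_algebra \<iota> for \<iota> :: "complex \<Rightarrow> 'a::comm_ring_1" +
  fixes p q :: "nat \<Rightarrow> int" and X :: "nat \<Rightarrow> 'a m2"
  assumes p_pos: "i < 3 \<Longrightarrow> p i \<ge> 1"
    and det: "k < 4 \<Longrightarrow> m2_det (X k) = 1"
    and h_central: "i < 3 \<Longrightarrow> X i * X 3 = X 3 * X i"
    and filling: "i < 3 \<Longrightarrow> X i ^ nat (p i) * zpow (X 3) (q i) = 1"
    and product: "X 0 * X 1 * X 2 = 1"
    and euler: "q 0 * p 1 * p 2 + q 1 * p 0 * p 2 + q 2 * p 0 * p 1 \<noteq> 0"
    and nonexceptional: "\<epsilon> = 1 \<or> \<epsilon> = -1 \<Longrightarrow>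
      (\<And>i. i < 3 \<Longrightarrow> w i ^ nat (p i) * \<epsilon> ^ nat \<bar>q i\<bar> = 1 \<and> (w i)\<^sup>2 \<noteq> 1) \<Longrightarrow>
      fricke (w 0 + inverse (w 0)) (w 1 + inverse (w 1)) (w 2 + inverse (w 2)) \<noteq> (0::complex)"
begin

lemma less_3_cases: "i < 3 \<Longrightarrow> (i::nat) = 0 \<or> i = 1 \<or> i = 2"
  by auto

lemma less_4_cases: "k < 4 \<Longrightarrow> (k::nat) < 3 \<or> k = 3"
  by auto

definition commuting :: bool where
  "commuting \<longleftrightarrow> (\<forall>i<4. \<forall>j<4. X i * X j = X j * X i)"

lemma commutingI:
  assumes "\<And>i j. i < 3 \<Longrightarrow> j < 3 \<Longrightarrow> X i * X j = X j * X i"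
  shows commuting
  unfolding commuting_def using assms h_central less_4_cases by metis

lemma product_rotate: "X 1 * X 2 * X 0 = 1" "X 2 * X 0 * X 1 = 1"
proof -
  show *: "X 1 * X 2 * X 0 = 1"
    using product m2_left_inverse_imp_right[of "X 0" "X 1 * X 2"] by (simp add: mult.assoc)
  show "X 2 * X 0 * X 1 = 1"
    using * m2_left_inverse_imp_right[of "X 1" "X 2 * X 0"] by (simp add: mult.assoc)
qed

text \<open>By the product relation the other two generators multiply to the inverse of the central
  one, and two invertible matrices with a central product commute.\<close>

lemma commuting_of_central:
  assumes i: "i < 3" and "\<And>j. j < 3 \<Longrightarrow> X i * X j = X j * X i"
  shows commuting
proof -
  have *: "A * B = B * A"
    if "m2_det A = 1" "m2_det Z = 1" "A * B * Z = 1" "Z * A = A * Z" for A B Z :: "'a m2"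
  proof (rule commute_of_central_product[OF that(1)])
    have "A * B = m2_adj Z"
      using eq_adj_of_inverse that by blast
    moreover have "A * m2_adj Z = m2_adj Z * A"
      using zpow_commute[of A Z "-1"] that(4) by (simp add: zpow_def)
    ultimately show "A * (A * B) = A * B * A" by simp
  qed
  have "X 0 * X 1 = X 1 * X 0 \<and> X 1 * X 2 = X 2 * X 1 \<and> X 2 * X 0 = X 0 * X 2"
    using less_3_cases[OF i]
  proof (elim disjE)
    assume "i = 0"
    thus ?thesis
      using assms(2) *[OF det det product_rotate(1)] by auto
  next
    assume "i = 1"
    thus ?thesis
      using assms(2) *[OF det det product_rotate(2)] by auto
  next
    assume "i = 2"
    thus ?thesis
      using assms(2) *[OF det det product] by auto
  qed
  thus ?thesis
    by (intro commutingI) (metis less_3_cases)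
qed

text \<open>By the filling relation this power is inverse to a power of the fibre
  \<open>X 3\<close>, which is central.\<close>

lemma filling_commute:
  assumes "i < 3" "j < 3"
  shows "X i ^ nat (p i) * X j = X j * X i ^ nat (p i)"
proof -
  let ?Z = "zpow (X 3) (q i)" and ?P = "X i ^ nat (p i)"
  have Z: "X j * ?Z = ?Z * X j"
    using zpow_commute[OF h_central[OF assms(2)]] .
  have PZ: "?P * ?Z = 1" "?Z * ?P = 1"
    using filling[OF assms(1)] m2_left_inverse_imp_right by blast+
  have "?P * X j = ?P * (X j * ?Z) * ?P"
    by (simp add: mult.assoc PZ)
  also have "\<dots> = (?P * ?Z) * X j * ?P"
    unfolding Z by (simp only: mult.assoc)
  finally show ?thesis by (simp add: PZ)
qed

text \<open>Raising c_1 c_2 c_3 = 1 to the power P = p_1 p_2 p_3 and eliminating the c_i by the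
  filling relations gives h^N = 1 with N = e(M) P, up to sign. So e(M) nonzero makes h, and then
  each c_i, torsion.\<close>

theorem commuting_imp_conj_constant:
  assumes commuting
  shows "conj_constant X"
proof -
  let ?H = "X 3" and ?p = "\<lambda>i. nat (p i)"
  define P where "P = ?p 0 * ?p 1 * ?p 2"
  define N where "N = q 0 * p 1 * p 2 + q 1 * p 0 * p 2 + q 2 * p 0 * p 1"
  \<comment> \<open>The quotient of \<open>P\<close> by the i-th multiplicity.\<close>
  define Pi where "Pi i = (if i = 0 then ?p 1 * ?p 2 else if i = 1 then ?p 0 * ?p 2 else ?p 0 * ?p 1)" for i :: nat
  have pp: "int (?p i) = p i" "?p i > 0" if "i < 3" for i
    using p_pos[OF that] by auto
  have P: "P = ?p i * Pi i" if "i < 3" for i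
    using less_3_cases[OF that] by (auto simp: P_def Pi_def)
  have detH: "m2_det ?H = 1" by (simp add: det)
  have comm: "X i * X j = X j * X i" if "i < 4" "j < 4" for i j
    using assms that by (simp add: commuting_def)
  have fill: "X i ^ (?p i * m) * zpow ?H (q i) ^ m = 1" if "i < 3" for i m
  proof -
    have "X i ^ ?p i * zpow ?H (q i) = zpow ?H (q i) * X i ^ ?p i"
      using filling[OF that] m2_left_inverse_imp_right by metis
    thus ?thesis
      using power_mult_distrib_commuting[of "X i ^ ?p i" "zpow ?H (q i)" m] filling[OF that]
      by (simp add: power_mult)
  qed
  have XP: "X i ^ P = zpow ?H (- (q i * int (Pi i)))" if "i < 3" for i
  proof -
    have "zpow ?H (q i * int (Pi i)) * zpow ?H (- (q i * int (Pi i))) = 1"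
      using zpow_add[OF detH, of "q i * int (Pi i)" "- (q i * int (Pi i))"]
      by (simp add: zpow_def[of _ 0])
    moreover have "X i ^ P * zpow ?H (q i * int (Pi i)) = 1"
      using fill[OF that, of "Pi i"] by (simp add: P[OF that] zpow_mult_nat[OF detH])
    ultimately show ?thesis
      by (rule left_inverse_eq_right_inverse[rotated])
  qed
  have "1 = (X 0 * X 1 * X 2) ^ P"
    by (simp only: product power_one)
  also have "\<dots> = X 0 ^ P * X 1 ^ P * X 2 ^ P"
  proof -
    have "X 0 * X 1 * X 2 = X 2 * (X 0 * X 1)"
      using comm[of 0 2] comm[of 1 2] by (simp add: mult.assoc) (simp flip: mult.assoc)
    thus ?thesis
      using power_mult_distrib_commuting[of "X 0 * X 1" "X 2" P]
        power_mult_distrib_commuting[OF comm[of 0 1], of P] by simp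
  qed
  also have "\<dots> = zpow ?H (- (q 0 * int (Pi 0)) + - (q 1 * int (Pi 1)) + - (q 2 * int (Pi 2)))"
    unfolding zpow_add[OF detH] by (simp add: XP)
  also have "- (q 0 * int (Pi 0)) + - (q 1 * int (Pi 1)) + - (q 2 * int (Pi 2)) = - N"
    using p_pos[of 0] p_pos[of 1] p_pos[of 2] by (simp add: Pi_def N_def algebra_simps)
  finally have H: "?H ^ nat \<bar>N\<bar> = 1"
    using zpow_eq_1_imp_power[of ?H "- N"] by simp
  define k where "k = nat \<bar>N\<bar>"
  have k: "k > 0" using euler by (simp add: k_def N_def)
  \<comment> \<open>The p_j-th power of c_j is inverse to a power of h, so its k-th power is
    trivial; \<open>P * k\<close> is thus a common exponent for all generators.\<close>
  show ?thesis
  proof (rule commuting_torsion_conj_constant[where n = "P * k"])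
    show "P * k > 0"
      using k pp by (simp add: P_def)
    fix j :: nat assume j: "j < 4"
    show "X j ^ (P * k) = 1"
    proof (cases "j < 3")
      case True
      have "X j ^ (?p j * k) = 1"
        using fill[OF True, of k] power_1_imp_zpow[OF H[folded k_def]] by simp
      moreover have "P * k = (?p j * k) * Pi j"
        by (simp add: P[OF True])
      ultimately show ?thesis by (simp only: power_mult power_one)
    next
      case False
      hence "j = 3" using j by simp
      thus ?thesis
        using H by (simp add: k_def mult.commute[of P] power_mult)
    qed
  qed (use det comm in auto)
qed

lemma m2_near_power:
  assumes "m2_small (A - B)"
  shows "m2_small (A ^ n - B ^ n)"
proof (induction n)
  case (Suc n)
  have "A ^ Suc n - B ^ Suc n = (A - B) * A ^ n + B * (A ^ n - B ^ n)"
    by (simp add: algebra_simps)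
  thus ?case
    using m2_small_add m2_small_times_left[OF assms] m2_small_times_right[OF Suc] by simp
qed (simp add: m2_small_0)

lemma sign_power_abs:
  fixes \<epsilon> :: complex
  assumes "\<epsilon> = 1 \<or> \<epsilon> = -1"
  shows "(\<epsilon> ^ n)\<^sup>2 = 1" "\<epsilon> ^ n * \<epsilon> ^ n = 1" "\<epsilon> ^ n \<noteq> 0"
  using assms by (auto simp: power2_eq_square power_mult_distrib[symmetric])

text \<open>The adjugate of a matrix near a scalar is near the same scalar, so a negative exponent
  enters by its absolute value.\<close>

lemma m2_near_zpow:
  assumes "m2_small (A - sc (\<iota> \<epsilon>))"
  shows "m2_small (zpow A n - sc (\<iota> (\<epsilon> ^ nat \<bar>n\<bar>)))"
proof -
  have "m2_small (m2_adj A - sc (\<iota> \<epsilon>))"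
    using assms small_uminus by (cases A) (auto simp: sc_def)
  thus ?thesis
    using assms m2_near_power by (auto simp: zpow_def hom_power sc_power)
qed

text \<open>Modulo the maximal ideal h is a scalar a with determinant a^2 = 1, so a - 1 or a + 1 is
  small.\<close>

lemma h_near_sign:
  assumes "X 3 = M2 a b c d" "small b" "small c" "small (a - d)"
  obtains \<epsilon> where "\<epsilon> = 1 \<or> \<epsilon> = -1" "m2_small (X 3 - sc (\<iota> \<epsilon>))"
proof -
  have "a * d - b * c = 1"
    using det[of 3] assms(1) by simp
  hence "(a - 1) * (a + 1) = a * (a - d) + b * c"
    by (simp add: algebra_simps)
  hence "small ((a - 1) * (a + 1))"
    using assms small_add small_mult_left small_mult_right by metis
  hence "small (a - 1) \<or> small (a + 1)"
    by (rule small_mult_cases)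
  moreover have "small (a - 1) \<Longrightarrow> small (d - 1)" "small (a + 1) \<Longrightarrow> small (d + 1)"
    using small_diff[OF _ assms(4), of "a - 1"] small_diff[OF _ assms(4), of "a + 1"]
    by (simp_all add: algebra_simps)
  ultimately have "m2_small (X 3 - sc (\<iota> 1)) \<or> m2_small (X 3 - sc (\<iota> (-1)))"
    using assms by (auto simp: sc_def hom_1 hom_uminus)
  thus ?thesis using that by blast
qed

lemma near_filling:
  assumes "m2_small (X 3 - sc (\<iota> \<epsilon>))" "\<epsilon> = 1 \<or> \<epsilon> = -1" "i < 3"
  shows "m2_small (X i ^ nat (p i) - sc (\<iota> (\<epsilon> ^ nat \<bar>q i\<bar>)))"
proof -
  let ?Z = "zpow (X 3) (q i)" and ?\<delta> = "sc (\<iota> (\<epsilon> ^ nat \<bar>q i\<bar>))" and ?P = "X i ^ nat (p i)"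
  have \<delta>: "?\<delta> * ?\<delta> = 1"
    using sign_power_abs[OF assms(2)] by (simp add: hom_1 sc_1 flip: sc_mult hom_mult)
  \<comment> \<open>The square of \<delta> and the filling relation are inserted to bring out the
    small factor \<open>?Z - ?\<delta>\<close>.\<close>
  have "?P - ?\<delta> = ?P * (?\<delta> * ?\<delta>) - (?P * ?Z) * ?\<delta>"
    using filling[OF assms(3)] by (simp add: \<delta>)
  also have "\<dots> = ?P * ((?Z - ?\<delta>) * - ?\<delta>)"
    by (simp add: algebra_simps)
  finally show ?thesis
    using m2_near_zpow[OF assms(1)] m2_small_times_left m2_small_times_right by presburger
qed

lemma unit_derivative:
  assumes "w\<^sup>2 = 1" "n > 0"
  shows "of_nat n * w ^ m \<noteq> (0::complex)"
  using assms by auto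

theorem seifert_conj_constant: "conj_constant X"
proof (cases commuting)
  case True
  thus ?thesis by (rule commuting_imp_conj_constant)
next
  case False
  obtain a b c d where H: "X 3 = M2 a b c d" by (cases "X 3")
  have ann: "sc t * (X i * X j - X j * X i) = 0" if "i < 3" "j < 3" "t \<in> {b, c, a - d}" for i j t
    using commutator_annihilated[of "X i" a b c d "X j" t] h_central that by (simp add: H)
  \<comment> \<open>A unit among the trace-free coordinates of h would, by \<open>ann\<close>, make
    all commutators of the c_i vanish.\<close>
  have "small t" if "t \<in> {b, c, a - d}" for t
    using False commutingI ann[OF _ _ that] m2_unit_cancel by (metis eq_iff_diff_eq_0)
  then obtain \<epsilon> where \<epsilon>: "\<epsilon> = 1 \<or> \<epsilon> = -1" "m2_small (X 3 - sc (\<iota> \<epsilon>))"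
    using h_near_sign[OF H] by blast
  define \<delta> where "\<delta> i = \<epsilon> ^ nat \<bar>q i\<bar>" for i
  have \<delta>: "\<delta> i ^ 2 = 1" "\<delta> i * \<delta> i = 1" "\<delta> i \<noteq> 0" for i
    unfolding \<delta>_def using sign_power_abs[OF \<epsilon>(1)] by blast+
  have "\<exists>w. w ^ nat (p i) = \<delta> i \<and> m2_tr (X i) \<approx> \<iota> (w + inverse w)" if "i < 3" for i
  proof -
    have "m2_det (X i) = 1" "nat (p i) > 0"
      using det p_pos[OF that] that by auto
    from near_eigenvalue[OF this \<delta>(3) near_filling[OF \<epsilon>(2,1) that, folded \<delta>_def]]
    show ?thesis by blast
  qed
  then obtain w where w: "\<And>i. i < 3 \<Longrightarrow> w i ^ nat (p i) = \<delta> i"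
    "\<And>i. i < 3 \<Longrightarrow> m2_tr (X i) \<approx> \<iota> (w i + inverse (w i))"
    by metis
  \<comment> \<open>With a double eigenvalue w the central matrix c_i^(p_i) equals \<alpha> c_i +
    \<beta>, where \<alpha> is congruent to p_i w^(p_i - 1), a unit. Hence c_i is central and
    everything would commute.\<close>
  have w_nonscalar: "(w i)\<^sup>2 \<noteq> 1" if i: "i < 3" for i
  proof
    assume "(w i)\<^sup>2 = 1"
    moreover obtain n where n: "nat (p i) = Suc n"
      using p_pos[OF i] by (cases "nat (p i)") auto
    ultimately obtain \<alpha> \<beta> where \<alpha>: "X i ^ nat (p i) = sc \<alpha> * X i + sc \<beta>" "\<alpha> \<approx> \<iota> (of_nat (Suc n) * w i ^ n)"
      using power_near_double_eigenvalue[OF det w(2)[OF i]] i by fastforce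
    have "\<not> small \<alpha>"
      using near_small[OF \<alpha>(2)] small_iota unit_derivative[OF \<open>(w i)\<^sup>2 = 1\<close>, of "Suc n"] by blast
    moreover have "sc \<alpha> * (X i * X j - X j * X i) = 0" if "j < 3" for j
      using filling_commute[OF i that] unfolding \<alpha>(1)
      by (simp add: algebra_simps sc_commute[of \<beta> "X j"]) (metis mult.assoc sc_commute)
    ultimately have "X i * X j = X j * X i" if "j < 3" for j
      using m2_unit_cancel that by (metis eq_iff_diff_eq_0)
    thus False
      using False commuting_of_central[OF i] by blast
  qed
  \<comment> \<open>Fricke's formula involves the trace of c_1 c_2, the inverse of c_3.\<close>
  have tr01: "m2_tr (X 0 * X 1) = m2_tr (X 2)"
  proof -
    have "X 0 * X 1 = m2_adj (X 2)"
      using eq_adj_of_inverse[OF det product] by simp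
    thus ?thesis by (cases "X 2") simp
  qed
  let ?f = "fricke (w 0 + inverse (w 0)) (w 1 + inverse (w 1)) (w 2 + inverse (w 2))"
  have "?f \<noteq> 0"
    using nonexceptional[OF \<epsilon>(1)] w(1) w_nonscalar \<delta>(2) unfolding \<delta>_def by presburger
  moreover have "m2_det (X 0 * X 1 - X 1 * X 0) \<approx> \<iota> ?f"
  proof -
    have "fricke (m2_tr (X 0)) (m2_tr (X 1)) (m2_tr (X 2)) \<approx>
        fricke (\<iota> (w 0 + inverse (w 0))) (\<iota> (w 1 + inverse (w 1))) (\<iota> (w 2 + inverse (w 2)))"
      unfolding fricke_def by (intro near_add near_diff near_mult near_refl w(2)) simp_all
    moreover have "fricke (\<iota> x) (\<iota> y) (\<iota> z) = \<iota> (fricke x y z)" for x y z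
      by (simp only: fricke_def hom_diff hom_add hom_mult hom_numeral)
    moreover have "m2_det (X 0 * X 1 - X 1 * X 0) = fricke (m2_tr (X 0)) (m2_tr (X 1)) (m2_tr (X 2))"
      unfolding tr01[symmetric] by (rule det_commutator) (simp_all add: det)
    ultimately show ?thesis by simp
  qed
  ultimately have unit: "\<not> small (m2_det (X 0 * X 1 - X 1 * X 0))"
    using near_small small_iota by blast
  \<comment> \<open>The unit determinant of c_1 c_2 - c_2 c_1 cancels from \<open>ann\<close>, so
    the trace-free part of h vanishes exactly.\<close>
  have "t = 0" if "t \<in> {b, c, a - d}" for t
  proof -
    have "sc t = 0"
      using m2_det_unit_cancel[OF unit ann[OF _ _ that]] by simp
    thus ?thesis by (simp add: sc_def zero_m2_def)
  qed
  from this[of b] this[of c] this[of "a - d"] have H': "b = 0" "c = 0" "d = a"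
    by simp_all
  \<comment> \<open>From det h = 1; the second factor is near 2 \<epsilon>, hence a unit, and
    cancels.\<close>
  have "(a - \<iota> \<epsilon>) * (a + \<iota> \<epsilon>) = 0"
    using det[of 3] \<epsilon>(1) by (auto simp: H H' hom_1 hom_uminus algebra_simps)
  moreover have "\<not> small (a + \<iota> \<epsilon>)"
  proof -
    have "a \<approx> \<iota> \<epsilon>"
      using \<epsilon>(2) by (simp add: H sc_def near_def)
    hence "a + \<iota> \<epsilon> \<approx> \<iota> (\<epsilon> + \<epsilon>)"
      unfolding hom_add by (intro near_add) auto
    thus ?thesis
      using near_small small_iota \<epsilon>(1) by fastforce
  qed
  ultimately have "a = \<iota> \<epsilon>"
    using unit_cancel[of "a + \<iota> \<epsilon>" "a - \<iota> \<epsilon>"] by (simp add: mult.commute)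
  hence X3: "X 3 = sc (\<iota> \<epsilon>)"
    by (simp add: H H' sc_def)
  \<comment> \<open>Now h is exactly \<epsilon>, so c_i^(p_i) is exactly a constant scalar and
    \<open>exact_trace\<close> applies.\<close>
  have trace: "m2_tr (X i) = \<iota> (w i + inverse (w i))" if i: "i < 3" for i
  proof -
    have "zpow (X 3) (q i) = sc (\<iota> (\<delta> i))"
      by (simp add: X3 \<delta>_def zpow_def hom_power sc_power) (simp add: sc_def)
    hence "X i ^ nat (p i) * sc (\<iota> (\<delta> i)) * sc (\<iota> (\<delta> i)) = sc (\<iota> (\<delta> i))"
      using filling[OF i] by simp
    hence "X i ^ nat (p i) = sc (\<iota> (\<delta> i))"
      using \<delta>(2) by (simp add: mult.assoc hom_1 sc_1 flip: sc_mult hom_mult)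
    thus ?thesis
      using exact_trace[of "X i" "nat (p i)" "\<delta> i" "w i"] det i p_pos[OF i] \<delta>(1) w w_nonscalar by simp
  qed
  have "w 0 \<noteq> 0"
    using w(1)[of 0] \<delta>(3)[of 0] p_pos[of 0] by (auto simp: zero_power)
  hence w0: "w 0 \<noteq> 0" "w 0 - inverse (w 0) \<noteq> 0"
    using w_nonscalar[of 0] by (auto simp: power2_eq_square) (metis right_inverse)
  obtain G where G: "\<not> small (m2_det G)" "X 0 * G = G * M2 (\<iota> (w 0)) 0 0 (\<iota> (inverse (w 0)))"
    using diagonalise[OF det trace w0(1) w_nonscalar] by auto
  obtain G' where G': "G * G' = 1" "G' * G = 1"
    using unit_det_inverse[OF G(1)] .
  define Y where "Y = G' * X 1 * G"
  define \<Delta> where "\<Delta> = M2 (\<iota> (w 0)) 0 0 (\<iota> (inverse (w 0)))"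
  \<comment> \<open>In an eigenbasis of c_1 the diagonal entries of c_2 solve the linear system
    given by the traces of c_2 and c_1 c_2; these are its solutions.\<close>
  define \<alpha> \<beta> where "\<alpha> = (w 2 + inverse (w 2) - inverse (w 0) * (w 1 + inverse (w 1))) / (w 0 - inverse (w 0))"
    and "\<beta> = w 1 + inverse (w 1) - \<alpha>"
  obtain y\<^sub>1 y\<^sub>2 y\<^sub>3 y\<^sub>4 where Y: "Y = M2 y\<^sub>1 y\<^sub>2 y\<^sub>3 y\<^sub>4" by (cases Y)
  have tr_conj: "m2_tr (G' * A * G) = m2_tr A" and det_conj: "m2_det (G' * A * G) = m2_det A" for A
  proof -
    show "m2_tr (G' * A * G) = m2_tr A"
      using m2_tr_commute[of "G' * A" G] G' by (simp flip: mult.assoc)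
    have "m2_det G * m2_det G' = 1"
      using m2_det_times[of G G'] G' by simp
    thus "m2_det (G' * A * G) = m2_det A"
      by (simp add: m2_det_times mult.commute mult.left_commute)
  qed
  have X1G: "X 1 * G = G * Y"
    by (simp add: Y_def mult.assoc[symmetric] G')
  have \<Delta>: "\<Delta> = G' * X 0 * G"
    using G(2) by (simp add: \<Delta>_def mult.assoc) (simp add: G' mult.assoc[symmetric])
  have \<Delta>Y: "\<Delta> * Y = G' * (X 0 * X 1) * G" "Y * \<Delta> = G' * (X 1 * X 0) * G"
  proof -
    have "\<Delta> * Y = G' * (X 0 * (G * G') * X 1) * G" "Y * \<Delta> = G' * (X 1 * (G * G') * X 0) * G"
      unfolding Y_def \<Delta> by (simp_all only: mult.assoc)
    thus "\<Delta> * Y = G' * (X 0 * X 1) * G" "Y * \<Delta> = G' * (X 1 * X 0) * G"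
      by (simp_all add: G')
  qed
  have e1: "y\<^sub>1 + y\<^sub>4 = \<iota> (w 1 + inverse (w 1))"
    using tr_conj[of "X 1", folded Y_def] trace[of 1] by (simp add: Y)
  have e2: "\<iota> (w 0) * y\<^sub>1 + \<iota> (inverse (w 0)) * y\<^sub>4 = \<iota> (w 2 + inverse (w 2))"
    using tr_conj[of "X 0 * X 1", folded \<Delta>Y] trace[of 2] unfolding tr01 by (simp add: \<Delta>_def Y)
  have e3: "y\<^sub>1 * y\<^sub>4 - y\<^sub>2 * y\<^sub>3 = 1"
    using det_conj[of "X 1", folded Y_def] det[of 1] by (simp add: Y)
  have "\<iota> (w 0 - inverse (w 0)) * (y\<^sub>1 - \<iota> \<alpha>) = 0"
  proof -
    have y4: "y\<^sub>4 = \<iota> (w 1 + inverse (w 1)) - y\<^sub>1" using e1 by (simp add: algebra_simps)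
    have "(w 0 - inverse (w 0)) * \<alpha> = w 2 + inverse (w 2) - inverse (w 0) * (w 1 + inverse (w 1))"
      using w0 by (simp add: \<alpha>_def)
    hence "\<iota> (w 0 - inverse (w 0)) * \<iota> \<alpha>
        = \<iota> (w 2 + inverse (w 2)) - \<iota> (inverse (w 0)) * \<iota> (w 1 + inverse (w 1))"
      by (simp only: hom_mult[symmetric] hom_diff[symmetric])
    also have "\<dots> = \<iota> (w 0 - inverse (w 0)) * y\<^sub>1"
      unfolding e2[symmetric] y4 hom_diff by (simp add: algebra_simps)
    finally show ?thesis by (simp add: right_diff_distrib)
  qed
  hence y1: "y\<^sub>1 = \<iota> \<alpha>"
    using unit_cancel small_iota w0(2) by (metis eq_iff_diff_eq_0)
  hence y4: "y\<^sub>4 = \<iota> \<beta>"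
    using e1 by (simp add: \<beta>_def hom_diff algebra_simps)
  have y23: "y\<^sub>2 * y\<^sub>3 = \<iota> (\<alpha> * \<beta> - 1)"
    using e3 by (simp add: y1 y4 hom_diff hom_mult hom_1 algebra_simps)
  \<comment> \<open>In the eigenbasis \<open>y\<^sub>2\<close> is a factor of the unit det (c_1 c_2
    - c_2 c_1).\<close>
  have "\<not> small y\<^sub>2"
  proof -
    have "\<Delta> * Y - Y * \<Delta> = G' * (X 0 * X 1 - X 1 * X 0) * G"
      by (simp add: \<Delta>Y algebra_simps)
    hence "\<not> small (m2_det (\<Delta> * Y - Y * \<Delta>))"
      using unit det_conj by simp
    moreover have "m2_det (\<Delta> * Y - Y * \<Delta>)
        = y\<^sub>2 * (y\<^sub>3 * ((\<iota> (w 0) - \<iota> (inverse (w 0))) * (\<iota> (w 0) - \<iota> (inverse (w 0)))))"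
      by (simp add: \<Delta>_def Y algebra_simps)
    ultimately show ?thesis
      using small_mult_left by metis
  qed
  \<comment> \<open>Rescaling the eigenbasis makes the upper right entry of c_2 equal to 1; the
    lower left entry becomes \<open>y\<^sub>2 * y\<^sub>3\<close>, the constant \<alpha> \<beta> -
    1.\<close>
  define S where "S = M2 y\<^sub>2 0 0 1"
  define D :: "nat \<Rightarrow> complex m2" where
    "D = (\<lambda>k. if k = 0 then M2 (w 0) 0 0 (inverse (w 0)) else M2 \<alpha> 1 (\<alpha> * \<beta> - 1) \<beta>)"
  \<comment> \<open>The third matrix is forced by the product relation, and the fibre is the scalar
    \<epsilon>.\<close>
  define D' where "D' = D(2 := m2_adj (D 0 * D 1), 3 := sc \<epsilon>)"
  have D0: "X 0 * (G * S) = G * S * m2_map \<iota> (D' 0)"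
  proof -
    have "\<Delta> * S = S * m2_map \<iota> (D' 0)"
      by (simp add: \<Delta>_def S_def D'_def D_def hom_0 mult.commute)
    thus ?thesis using G(2) \<Delta>_def by (metis mult.assoc)
  qed
  have D1: "X 1 * (G * S) = G * S * m2_map \<iota> (D' 1)"
  proof -
    have "Y * S = S * m2_map \<iota> (D' 1)"
      using y23 by (simp add: Y S_def D'_def D_def hom_1 y1 y4 mult.commute)
    thus ?thesis using X1G by (metis mult.assoc)
  qed
  have D2: "X 2 * (G * S) = G * S * m2_map \<iota> (D' 2)"
  proof -
    have m: "m2_map \<iota> (A * B) = m2_map \<iota> A * m2_map \<iota> B" for A B
      by (cases A; cases B) (simp add: hom_add hom_mult)
    have "m2_det (D' 0 * D' 1) = 1"
      using w0(1) unfolding m2_det_times by (simp add: D'_def D_def)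
    hence "D' 0 * D' 1 * D' 2 = 1"
      using m2_adj_inverse by (simp add: D'_def)
    hence inv: "m2_map \<iota> (D' 0) * m2_map \<iota> (D' 1) * m2_map \<iota> (D' 2) = 1"
      by (simp flip: m) (simp add: m2_one hom_0 hom_1)
    have "X 2 * (G * S) = X 2 * (G * S) * (m2_map \<iota> (D' 0) * m2_map \<iota> (D' 1) * m2_map \<iota> (D' 2))"
      unfolding inv by simp
    also have "\<dots> = X 2 * (G * S * m2_map \<iota> (D' 0)) * m2_map \<iota> (D' 1) * m2_map \<iota> (D' 2)"
      by (simp only: mult.assoc)
    also have "\<dots> = X 2 * X 0 * (G * S * m2_map \<iota> (D' 1)) * m2_map \<iota> (D' 2)"
      unfolding D0[symmetric] by (simp only: mult.assoc)
    also have "\<dots> = X 2 * X 0 * X 1 * (G * S) * m2_map \<iota> (D' 2)"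
      unfolding D1[symmetric] by (simp only: mult.assoc)
    finally show ?thesis unfolding product_rotate(2) by simp
  qed
  have D3: "X 3 * (G * S) = G * S * m2_map \<iota> (D' 3)"
  proof -
    have "m2_map \<iota> (D' 3) = sc (\<iota> \<epsilon>)"
      by (simp add: D'_def sc_def hom_0)
    thus ?thesis by (simp add: X3 sc_commute)
  qed
  have "\<not> small (m2_det (G * S))"
    using G(1) \<open>\<not> small y\<^sub>2\<close> small_mult_cases by (auto simp: m2_det_times S_def)
  moreover have "X k * (G * S) = G * S * m2_map \<iota> (D' k)" if "k < 4" for k
    using that D0 D1 D2 D3 less_3_cases[of k] less_4_cases[of k] by metis
  ultimately show ?thesis
    unfolding conj_constant_def by blast
qed

end

section \<open>Representations over an arbitrary ring, conjugation and base change\<close>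

definition gen_rep :: "(nat \<Rightarrow> int) \<Rightarrow> (nat \<Rightarrow> int) \<Rightarrow> (nat \<Rightarrow> 'a::comm_ring_1 m2) \<Rightarrow> bool" where
  "gen_rep p q X \<longleftrightarrow> (\<forall>k<4. m2_det (X k) = 1) \<and> (\<forall>r \<in> set (relators p q). eval_word X r = 1)"

lemma is_rep_iff_gen_rep: "is_rep p q \<rho> \<longleftrightarrow> gen_rep p q \<rho>"
  by (simp add: is_rep_def gen_rep_def)

lemma eval_word_append: "eval_word X (u @ v) = eval_word X u * eval_word X v"
  by (induction X u rule: eval_word.induct) (simp_all add: mult.assoc)

lemma eval_word_replicate:
  "eval_word X (replicate n (k, b)) = (if b then m2_adj (X k) else X k) ^ n"
  by (induction n) simp_all

lemma eval_word_wpow: "eval_word X (wpow k n) = zpow (X k) n"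
  by (simp add: wpow_def zpow_def eval_word_replicate)

text \<open>Determinant one makes the adjugates in the commutator relators genuine inverses, which
  turns the relators into equations.\<close>

lemma gen_rep_iff:
  "gen_rep p q X \<longleftrightarrow> (\<forall>k<4. m2_det (X k) = 1) \<and> (\<forall>i<3. X i * X 3 = X 3 * X i)
     \<and> (\<forall>i<3. zpow (X i) (p i) * zpow (X 3) (q i) = 1) \<and> X 0 * X 1 * X 2 = 1"
proof -
  have "A * (B * (m2_adj A * m2_adj B)) = 1 \<longleftrightarrow> A * B = B * A"
    if "m2_det A = 1" "m2_det B = 1" for A B :: "'a m2"
  proof -
    have inv: "m2_adj A * m2_adj B * (B * A) = 1"
    proof -
      have "m2_adj A * m2_adj B * (B * A) = m2_adj A * (m2_adj B * B) * A"
        by (simp only: mult.assoc)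
      thus ?thesis by (simp add: m2_adj_inverse that)
    qed
    show ?thesis
    proof
      assume "A * (B * (m2_adj A * m2_adj B)) = 1"
      hence "A * B * (m2_adj A * m2_adj B) = 1"
        by (simp only: mult.assoc)
      thus "A * B = B * A"
        using inv by (rule left_inverse_eq_right_inverse)
    next
      assume "A * B = B * A"
      thus "A * (B * (m2_adj A * m2_adj B)) = 1"
        using m2_left_inverse_imp_right[OF inv] by (simp only: mult.assoc[symmetric])
    qed
  qed
  note commutator = this
  have all3: "(\<forall>i<3. Q i) \<longleftrightarrow> Q 0 \<and> Q 1 \<and> Q (2::nat)" for Q
    by (auto simp: numeral_3_eq_3 numeral_2_eq_2 less_Suc_eq)
  show ?thesis
  proof (cases "\<forall>k<4. m2_det (X k) = 1")
    case True
    hence "m2_det (X 0) = 1" "m2_det (X 1) = 1" "m2_det (X 2) = 1" "m2_det (X 3) = 1"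
      by simp_all
    thus ?thesis
      unfolding gen_rep_def using True
      by (simp add: relators_def gen_h_def eval_word_append eval_word_wpow commutator all3
          mult.assoc)
  next
    case False
    thus ?thesis unfolding gen_rep_def by blast
  qed
qed

lemma relators_letters: "r \<in> set (relators p q) \<Longrightarrow> l \<in> set r \<Longrightarrow> fst l < 4"
  by (auto simp: relators_def gen_h_def wpow_def split: if_splits)

lemma conj_eval_word:
  fixes X Y :: "nat \<Rightarrow> 'a::comm_ring_1 m2"
  assumes "\<And>k. k < 4 \<Longrightarrow> X k * G = G * Y k"
    and "\<And>k. k < 4 \<Longrightarrow> m2_det (X k) = 1" "\<And>k. k < 4 \<Longrightarrow> m2_det (Y k) = 1"
    and "\<And>l. l \<in> set r \<Longrightarrow> fst l < 4"
  shows "eval_word X r * G = G * eval_word Y r"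
  using assms(4)
proof (induction r)
  case Nil
  thus ?case by (simp)
next
  case (Cons l r)
  obtain k b where l: "l = (k, b)" by (cases l)
  have k: "k < 4" using Cons.prems[of l] by (simp add: l)
  have "m2_adj (X k) * G = m2_adj (X k) * (G * Y k) * m2_adj (Y k)"
    by (simp add: mult.assoc m2_adj_inverse assms k)
  also have "\<dots> = m2_adj (X k) * X k * G * m2_adj (Y k)"
    unfolding assms(1)[OF k, symmetric] by (simp only: mult.assoc)
  finally have adj: "m2_adj (X k) * G = G * m2_adj (Y k)"
    by (simp add: m2_adj_inverse assms k)
  let ?x = "if b then m2_adj (X k) else X k" and ?y = "if b then m2_adj (Y k) else Y k"
  have "?x * (eval_word X r * G) = ?x * G * eval_word Y r"
    using Cons by (simp add: mult.assoc)
  also have "?x * G = G * ?y"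
    using adj assms(1)[OF k] by simp
  finally show ?case by (simp add: l mult.assoc)
qed

lemma gen_rep_conj:
  fixes X Y :: "nat \<Rightarrow> 'a::comm_ring_1 m2"
  assumes "G * G' = 1" "\<And>k. k < 4 \<Longrightarrow> X k * G = G * Y k"
    and "\<And>k. k < 4 \<Longrightarrow> m2_det (X k) = 1" "\<And>k. k < 4 \<Longrightarrow> m2_det (Y k) = 1"
  shows "gen_rep p q X \<longleftrightarrow> gen_rep p q Y"
proof -
  have G': "G' * G = 1" by (rule m2_left_inverse_imp_right[OF assms(1)])
  have "eval_word X r = 1 \<longleftrightarrow> eval_word Y r = 1" if "r \<in> set (relators p q)" for r
  proof -
    have e: "eval_word X r * G = G * eval_word Y r"
      using conj_eval_word[of X G Y r] assms relators_letters[OF that] by blast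
    have "eval_word X r = eval_word X r * G * G'" "eval_word Y r = G' * (G * eval_word Y r)"
      by (simp_all add: mult.assoc assms(1)) (simp add: mult.assoc[symmetric] G')
    thus ?thesis
      using e assms(1) G' by (metis mult_1_left mult_1_right)
  qed
  thus ?thesis
    using assms(3,4) by (simp add: gen_rep_def)
qed

lemma m2_map_hom:
  fixes \<phi> :: "'a::comm_ring_1 \<Rightarrow> 'b::comm_ring_1"
  assumes "\<And>x y. \<phi> (x + y) = \<phi> x + \<phi> y" "\<And>x y. \<phi> (x * y) = \<phi> x * \<phi> y" "\<phi> 1 = 1"
  shows "m2_map \<phi> (A * B) = m2_map \<phi> A * m2_map \<phi> B" "m2_map \<phi> (m2_adj A) = m2_adj (m2_map \<phi> A)"
    "m2_map \<phi> 1 = 1" "m2_det (m2_map \<phi> A) = \<phi> (m2_det A)"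
    "m2_map \<phi> (eval_word X r) = eval_word (\<lambda>k. m2_map \<phi> (X k)) r"
proof -
  have zero: "\<phi> 0 = 0"
    using assms(1)[of 0 0] by simp
  have uminus: "\<phi> (- x) = - \<phi> x" for x
    using assms(1)[of x "- x"] zero by (simp add: eq_neg_iff_add_eq_0 add.commute)
  have diff: "\<phi> (x - y) = \<phi> x - \<phi> y" for x y
    using assms(1)[of x "- y"] by (simp add: uminus)
  show mult: "m2_map \<phi> (A * B) = m2_map \<phi> A * m2_map \<phi> B" for A B
    by (cases A; cases B) (simp add: assms)
  show adj: "m2_map \<phi> (m2_adj A) = m2_adj (m2_map \<phi> A)" for A
    by (cases A) (simp add: uminus)
  show one: "m2_map \<phi> 1 = 1"
    by (simp add: m2_one zero assms)
  show "m2_det (m2_map \<phi> A) = \<phi> (m2_det A)"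
    by (cases A) (simp add: assms diff)
  show "m2_map \<phi> (eval_word X r) = eval_word (\<lambda>k. m2_map \<phi> (X k)) r"
    by (induction X r rule: eval_word.induct) (simp_all add: mult adj one)
qed


section \<open>Exceptional abelian characters\<close>

text \<open>In the third trace t the negative of the Fricke polynomial splits as (t - (xy + 1/(xy)))
  (t - (x/y + y/x)). If either factor vanishes, the eigenvalues, up to inversion, multiply to
  1.\<close>

lemma fricke_factor:
  fixes x y z :: complex
  assumes "x \<noteq> 0" "y \<noteq> 0" "z \<noteq> 0"
    and "fricke (x + inverse x) (y + inverse y) (z + inverse z) = 0"
  obtains v where "v = y \<or> v = inverse y" "inverse (x * v) = z \<or> inverse (x * v) = inverse z"
proof -
  have xy: "x * inverse x = 1" "y * inverse y = 1"
    using assms by auto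
  let ?t = "z + inverse z"
  have "(?t - (x * y + inverse x * inverse y)) * (?t - (x * inverse y + inverse x * y))
      = - fricke (x + inverse x) (y + inverse y) ?t"
    using assms(1,2) by (simp add: fricke_def field_simps)
  hence "?t = x * y + inverse (x * y) \<or> ?t = x * inverse y + inverse (x * inverse y)"
    using assms(4) by auto
  then obtain v where v: "v = y \<or> v = inverse y" "?t = x * v + inverse (x * v)"
    by blast
  hence "x * v \<noteq> 0" using assms by auto
  hence "z = x * v \<or> z = inverse (x * v)"
    using sum_inverse_eq_iff[of z "x * v"] assms(3) v(2) by blast
  thus ?thesis using that[OF v(1)] by auto
qed

text \<open>Vanishing would yield a diagonal representation with h = \<epsilon> whose eigenvalues
  are the w i up to inversion, none of them \<plusminus>1; its own character would be
  exceptional.\<close>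

lemma fricke_nonzero_of_nonexceptional:
  fixes w :: "nat \<Rightarrow> complex"
  assumes "\<not> has_exceptional_abelian_character p q"
    and p: "\<And>i. i < 3 \<Longrightarrow> p i \<ge> 1"
    and \<epsilon>: "\<epsilon> = 1 \<or> \<epsilon> = -1"
    and w: "\<And>i. i < 3 \<Longrightarrow> w i ^ nat (p i) * \<epsilon> ^ nat \<bar>q i\<bar> = 1 \<and> (w i)\<^sup>2 \<noteq> 1"
  shows "fricke (w 0 + inverse (w 0)) (w 1 + inverse (w 1)) (w 2 + inverse (w 2)) \<noteq> 0"
proof
  assume fr: "fricke (w 0 + inverse (w 0)) (w 1 + inverse (w 1)) (w 2 + inverse (w 2)) = 0"
  have w_nz: "w i \<noteq> 0" if "i < 3" for i
    using w[OF that] p[OF that] by (auto simp: zero_power)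
  obtain v where v: "v = w 1 \<or> v = inverse (w 1)"
    "inverse (w 0 * v) = w 2 \<or> inverse (w 0 * v) = inverse (w 2)"
    using fricke_factor[OF w_nz w_nz w_nz fr] by auto
  \<comment> \<open>The third eigenvalue is prescribed by the product relation; the choice of
    \<open>v\<close> makes it \<open>w 2\<close> or its inverse.\<close>
  define u where "u k = (if k = 0 then w 0 else if k = 1 then v else inverse (w 0 * v))" for k :: nat
  define \<rho> where "\<rho> k = (if k < 3 then M2 (u k) 0 0 (inverse (u k)) else sc \<epsilon>)" for k
  have u: "u i = w i \<or> u i = inverse (w i)" if "i < 3" for i
    using v that by (auto simp: u_def numeral_3_eq_3 numeral_2_eq_2 less_Suc_eq)
  have u_nz: "u i \<noteq> 0" if "i < 3" for i
    using u[OF that] w_nz[OF that] by auto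
  have \<epsilon>_inv: "inverse (\<epsilon> ^ n) = \<epsilon> ^ n" for n
    using \<epsilon> by (auto simp flip: power_inverse)
  have u_power: "u i ^ nat (p i) * \<epsilon> ^ nat \<bar>q i\<bar> = 1" if "i < 3" for i
  proof -
    have "inverse (w i ^ nat (p i) * \<epsilon> ^ nat \<bar>q i\<bar>) = 1"
      using w[OF that] by simp
    hence "inverse (w i) ^ nat (p i) * \<epsilon> ^ nat \<bar>q i\<bar> = 1"
      by (simp add: \<epsilon>_inv power_inverse)
    thus ?thesis using u[OF that] w[OF that] by metis
  qed
  have u_sq: "u i \<noteq> 1" "u i \<noteq> -1" if "i < 3" for i
    using u[OF that] w[OF that] by (auto simp: power2_eq_square inverse_eq_1_iff
        dest: arg_cong[of _ _ inverse])
  have diag_power: "M2 x 0 0 y ^ n = M2 (x ^ n) 0 0 (y ^ n)" for x y :: complex and n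
    by (induction n) (simp_all add: m2_one)
  have "is_rep p q \<rho>"
    unfolding is_rep_iff_gen_rep gen_rep_iff
  proof (intro conjI allI impI)
    fix k :: nat assume "k < 4"
    thus "m2_det (\<rho> k) = 1"
      using u_nz \<epsilon> by (auto simp: \<rho>_def sc_def)
  next
    fix i :: nat assume i: "i < 3"
    show "\<rho> i * \<rho> 3 = \<rho> 3 * \<rho> i"
      by (simp add: \<rho>_def sc_commute)
    have "zpow (\<rho> 3) (q i) = sc (\<epsilon> ^ nat \<bar>q i\<bar>)"
      by (simp add: zpow_def \<rho>_def sc_power) (simp add: sc_def)
    moreover have "zpow (\<rho> i) (p i) = M2 (u i ^ nat (p i)) 0 0 (inverse (u i ^ nat (p i)))"
      using p[OF i] i by (simp add: zpow_def \<rho>_def diag_power power_inverse)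
    moreover have "inverse (u i ^ nat (p i)) * \<epsilon> ^ nat \<bar>q i\<bar> = 1"
    proof -
      have "inverse (u i ^ nat (p i) * \<epsilon> ^ nat \<bar>q i\<bar>) = 1"
        using u_power[OF i] by simp
      thus ?thesis by (simp add: \<epsilon>_inv)
    qed
    ultimately show "zpow (\<rho> i) (p i) * zpow (\<rho> 3) (q i) = 1"
      using u_power[OF i] by (simp add: sc_def m2_one)
  next
    have "u 0 * u 1 * u 2 = 1"
      using u_nz[of 0] u_nz[of 1] by (simp add: u_def field_simps)
    moreover from this have "inverse (u 0) * inverse (u 1) * inverse (u 2) = 1"
      by (metis inverse_1 inverse_mult_distrib)
    ultimately show "\<rho> 0 * \<rho> 1 * \<rho> 2 = 1"
      by (simp add: \<rho>_def m2_one)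
  qed
  moreover have "diagonal_rep \<rho>"
    by (simp add: diagonal_rep_def \<rho>_def sc_def)
  moreover have "pm_id (\<rho> gen_h)"
    using \<epsilon> by (auto simp: pm_id_def \<rho>_def gen_h_def sc_def m2_one)
  moreover have "\<not> pm_id (\<rho> i)" if "i < 3" for i
    using u_sq[OF that] that by (simp add: pm_id_def \<rho>_def m2_one)
  \<comment> \<open>The same \<open>\<rho>\<close> serves as both representations in the definition
    of an exceptional character.\<close>
  ultimately show False
    using assms(1) unfolding has_exceptional_abelian_character_def same_character_def by blast
qed

lemma euler_number_nonzero:
  assumes "\<And>i. i < 3 \<Longrightarrow> p i \<ge> 1" "euler_number p q \<noteq> 0"
  shows "q 0 * p 1 * p 2 + q 1 * p 0 * p 2 + q 2 * p 0 * p 1 \<noteq> 0"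
proof
  assume 0: "q 0 * p 1 * p 2 + q 1 * p 0 * p 2 + q 2 * p 0 * p 1 = 0"
  have nz: "p 0 \<noteq> 0" "p 1 \<noteq> 0" "p 2 \<noteq> 0"
    using assms(1)[of 0] assms(1)[of 1] assms(1)[of 2] by auto
  have "euler_number p q = of_int (q 0 * p 1 * p 2 + q 1 * p 0 * p 2 + q 2 * p 0 * p 1)
      / of_int (p 0 * p 1 * p 2)"
    using nz by (simp add: euler_number_def numeral_3_eq_3 numeral_2_eq_2 field_simps)
  thus False using assms(2) unfolding 0 by simp
qed

section \<open>Descent to a complex representation\<close>

context local_algebra
begin

text \<open>The constant matrices satisfy the relations over the local ring, being conjugate to
  \<open>X\<close>; injectivity of \<iota> brings the relations back to the complex numbers.\<close>

lemma gen_rep_conj_constant: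
  assumes "\<And>i. i < 3 \<Longrightarrow> p i \<ge> 1" "euler_number p q \<noteq> 0"
    and "\<not> has_exceptional_abelian_character p q"
    and "gen_rep p q X"
  obtains G D where "\<not> small (m2_det G)" "\<And>k. k < 4 \<Longrightarrow> X k * G = G * m2_map \<iota> (D k)"
    "gen_rep p q D"
proof -
  have zpow_p: "zpow (X i) (p i) = X i ^ nat (p i)" if "i < 3" for i
    using assms(1)[OF that] by (simp add: zpow_def)
  interpret seifert_rep \<iota> p q X
  proof unfold_locales
    fix i :: nat assume "i < 3"
    thus "X i ^ nat (p i) * zpow (X 3) (q i) = 1"
      using assms(4) by (simp add: gen_rep_iff flip: zpow_p)
  qed (use assms euler_number_nonzero[OF assms(1,2)] fricke_nonzero_of_nonexceptional[OF assms(3,1)]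
       in \<open>simp_all add: gen_rep_iff\<close>)
  obtain G D where G: "\<not> small (m2_det G)" "\<And>k. k < 4 \<Longrightarrow> X k * G = G * m2_map \<iota> (D k)"
    using seifert_conj_constant unfolding conj_constant_def by blast
  obtain G' where G': "G * G' = 1" "G' * G = 1"
    using unit_det_inverse[OF G(1)] .
  note map = m2_map_hom[of \<iota>, OF hom_add hom_mult hom_1]
  have detD: "m2_det (m2_map \<iota> (D k)) = 1" if "k < 4" for k
  proof -
    have "m2_det G * m2_det G' = 1"
      using G' m2_det_times[of G G'] by simp
    moreover have "m2_det G * m2_det (m2_map \<iota> (D k)) = m2_det G"
      using G(2)[OF that] det[OF that] m2_det_times by (metis mult_1_left)
    ultimately show ?thesis
      by (metis mult.assoc mult.commute mult_1_left)
  qed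
  have rep: "gen_rep p q (\<lambda>k. m2_map \<iota> (D k))"
    using gen_rep_conj[OF G'(1), of X "\<lambda>k. m2_map \<iota> (D k)"] G(2) det detD assms(4) by blast
  have inj: "m2_map \<iota> A = 1 \<longleftrightarrow> A = 1" for A
    by (cases A) (auto simp: m2_one hom_inj simp flip: hom_0 hom_1)
  have "gen_rep p q D"
    unfolding gen_rep_def
  proof (intro conjI allI impI ballI)
    fix k :: nat assume "k < 4"
    hence "\<iota> (m2_det (D k)) = \<iota> 1"
      using detD by (simp add: map hom_1)
    thus "m2_det (D k) = 1" by (simp add: hom_inj)
  next
    fix r assume "r \<in> set (relators p q)"
    hence "m2_map \<iota> (eval_word D r) = 1"
      using rep by (simp add: gen_rep_def map)
    thus "eval_word D r = 1" by (simp add: inj)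
  qed
  thus ?thesis using that G by blast
qed

end

section \<open>Evaluating polynomials\<close>

locale comm_complex_algebra = complex_algebra \<iota> for \<iota> :: "complex \<Rightarrow> 'a::comm_ring_1"

sublocale local_algebra \<subseteq> comm_complex_algebra ..

definition monom_eval :: "(nat \<Rightarrow> 'a::comm_ring_1) \<Rightarrow> (nat \<Rightarrow>\<^sub>0 nat) \<Rightarrow> 'a" where
  "monom_eval s m = (\<Prod>v\<in>Poly_Mapping.keys m. s v ^ Poly_Mapping.lookup m v)"

lemma monom_eval_superset:
  assumes "finite A" "Poly_Mapping.keys m \<subseteq> A"
  shows "monom_eval s m = (\<Prod>v\<in>A. s v ^ Poly_Mapping.lookup m v)"
  unfolding monom_eval_def using assms by (intro prod.mono_neutral_left) (auto simp: in_keys_iff)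

lemma monom_eval_add: "monom_eval s (m + n) = monom_eval s m * monom_eval s n"
proof -
  let ?A = "Poly_Mapping.keys m \<union> Poly_Mapping.keys n"
  have "monom_eval s (m + n) = (\<Prod>v\<in>?A. s v ^ Poly_Mapping.lookup (m + n) v)"
    using keys_add[of m n] by (intro monom_eval_superset) auto
  also have "\<dots> = (\<Prod>v\<in>?A. s v ^ Poly_Mapping.lookup m v) * (\<Prod>v\<in>?A. s v ^ Poly_Mapping.lookup n v)"
    by (simp add: lookup_add power_add prod.distrib)
  finally show ?thesis
    by (simp add: monom_eval_superset[of ?A])
qed

lemma monom_eval_0: "monom_eval s 0 = 1"
  by (simp add: monom_eval_def)

lemma poly_mapping_eq_sum_single:
  "f = (\<Sum>m\<in>Poly_Mapping.keys f. Poly_Mapping.single m (Poly_Mapping.lookup f m))"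
proof (rule poly_mapping_eqI)
  fix k
  show "Poly_Mapping.lookup f k =
      Poly_Mapping.lookup (\<Sum>m\<in>Poly_Mapping.keys f. Poly_Mapping.single m (Poly_Mapping.lookup f m)) k"
    by (cases "k \<in> Poly_Mapping.keys f")
       (auto simp: lookup_sum lookup_single when_def in_keys_iff)
qed

lemma single_eq_pconst_mult:
  "Poly_Mapping.single m c = pconst c * monom_eval pvar m"
proof -
  have power: "pvar v ^ k = Poly_Mapping.single (Poly_Mapping.single v k) 1" for v k
    by (induction k) (simp_all add: pvar_def mult_single flip: single_add)
  have "(\<Prod>v\<in>A. Poly_Mapping.single (g v) (1::complex)) = Poly_Mapping.single (\<Sum>v\<in>A. g v) 1"
    if "finite A" for A and g :: "nat \<Rightarrow> (nat \<Rightarrow>\<^sub>0 nat)"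
    using that by (induction rule: finite_induct) (simp_all add: mult_single)
  hence "monom_eval pvar m = Poly_Mapping.single m 1"
    by (simp add: monom_eval_def power flip: poly_mapping_eq_sum_single)
  thus ?thesis by (simp add: pconst_def mult_single)
qed

lemma pconst_add: "pconst (a + b) = pconst a + pconst b"
  and pconst_mult: "pconst (a * b) = pconst a * pconst b"
  and pconst_1: "pconst 1 = 1"
  by (simp_all add: pconst_def single_add mult_single)

context comm_complex_algebra
begin

text \<open>Values may lie in any commutative complex algebra, so complex points and points over the
  local ring are treated alike.\<close>

definition peval :: "(nat \<Rightarrow> 'a) \<Rightarrow> cpoly \<Rightarrow> 'a" where
  "peval s f = (\<Sum>m\<in>Poly_Mapping.keys f. \<iota> (Poly_Mapping.lookup f m) * monom_eval s m)"

lemma peval_superset: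
  assumes "finite A" "Poly_Mapping.keys f \<subseteq> A"
  shows "peval s f = (\<Sum>m\<in>A. \<iota> (Poly_Mapping.lookup f m) * monom_eval s m)"
  unfolding peval_def using assms by (intro sum.mono_neutral_left) (auto simp: in_keys_iff hom_0)

lemma peval_add: "peval s (f + g) = peval s f + peval s g"
proof -
  let ?A = "Poly_Mapping.keys f \<union> Poly_Mapping.keys g"
  have "peval s (f + g) = (\<Sum>m\<in>?A. \<iota> (Poly_Mapping.lookup (f + g) m) * monom_eval s m)"
    using keys_add[of f g] by (intro peval_superset) auto
  also have "\<dots> = (\<Sum>m\<in>?A. \<iota> (Poly_Mapping.lookup f m) * monom_eval s m)
      + (\<Sum>m\<in>?A. \<iota> (Poly_Mapping.lookup g m) * monom_eval s m)"
    by (simp add: lookup_add hom_add algebra_simps sum.distrib)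
  finally show ?thesis
    by (simp add: peval_superset[of ?A])
qed

lemma peval_single: "peval s (Poly_Mapping.single m c) = \<iota> c * monom_eval s m"
  by (simp add: peval_superset[of "{m}"])

lemma peval_0: "peval s 0 = 0"
  by (simp add: peval_def)

lemma peval_sum: "peval s (\<Sum>x\<in>A. f x) = (\<Sum>x\<in>A. peval s (f x))"
  by (induction A rule: infinite_finite_induct) (simp_all add: peval_0 peval_add)

lemma peval_mult: "peval s (f * g) = peval s f * peval s g"
proof -
  let ?c = "Poly_Mapping.lookup"
  have "f * g = (\<Sum>m\<in>Poly_Mapping.keys f. \<Sum>n\<in>Poly_Mapping.keys g.
      Poly_Mapping.single (m + n) (?c f m * ?c g n))"
    by (subst poly_mapping_eq_sum_single[of f], subst poly_mapping_eq_sum_single[of g])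
       (simp add: sum_product mult_single)
  hence "peval s (f * g) = (\<Sum>m\<in>Poly_Mapping.keys f. \<Sum>n\<in>Poly_Mapping.keys g.
      (\<iota> (?c f m) * monom_eval s m) * (\<iota> (?c g n) * monom_eval s n))"
    by (simp add: peval_sum peval_single hom_mult monom_eval_add algebra_simps)
  thus ?thesis
    by (simp add: peval_def sum_product)
qed

lemma peval_pconst: "peval s (pconst c) = \<iota> c"
  by (simp add: pconst_def peval_single monom_eval_0)

lemma peval_pvar: "peval s (pvar v) = s v"
  by (simp add: pvar_def peval_single monom_eval_def hom_1)

lemma peval_1: "peval s 1 = 1"
  using peval_pconst[of s 1] by (simp add: pconst_1 hom_1)

lemma peval_power: "peval s (f ^ n) = peval s f ^ n"
  by (induction n) (simp_all add: peval_1 peval_mult)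

lemma peval_prod: "peval s (\<Prod>x\<in>A. f x) = (\<Prod>x\<in>A. peval s (f x))"
  by (induction A rule: infinite_finite_induct) (simp_all add: peval_1 peval_mult)

lemma peval_monom_eval: "peval s (monom_eval t m) = monom_eval (\<lambda>v. peval s (t v)) m"
  by (simp add: monom_eval_def peval_prod peval_power)

lemma peval_diff: "peval s (f - g) = peval s f - peval s g"
  using peval_add[of s "f - g" g] by (simp add: algebra_simps)

lemmas m2_map_peval = m2_map_hom[of "peval s" for s, OF peval_add peval_mult peval_1]

text \<open>Universal property of the polynomial ring; at the end it identifies
  \<open>of_cpoly f\<close> with the value of f at the universal representation.\<close>

lemma hom_eq_peval:
  fixes \<phi> :: "cpoly \<Rightarrow> 'a"
  assumes "\<And>x y. \<phi> (x + y) = \<phi> x + \<phi> y" "\<And>x y. \<phi> (x * y) = \<phi> x * \<phi> y" "\<phi> 1 = 1"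
    and "\<And>c. \<phi> (pconst c) = \<iota> c"
  shows "\<phi> f = peval (\<lambda>v. \<phi> (pvar v)) f"
proof -
  have 0: "\<phi> 0 = 0"
    using assms(1)[of 0 0] by simp
  have sum: "\<phi> (\<Sum>x\<in>A. g x) = (\<Sum>x\<in>A. \<phi> (g x))" for A and g :: "(nat \<Rightarrow>\<^sub>0 nat) \<Rightarrow> cpoly"
    by (induction A rule: infinite_finite_induct) (simp_all add: 0 assms)
  have power: "\<phi> (x ^ n) = \<phi> x ^ n" for x n
    by (induction n) (simp_all add: assms)
  have "\<phi> (\<Prod>x\<in>A. g x) = (\<Prod>x\<in>A. \<phi> (g x))" for A and g :: "nat \<Rightarrow> cpoly"
    by (induction A rule: infinite_finite_induct) (simp_all add: assms)
  hence "\<phi> (monom_eval pvar m) = monom_eval (\<lambda>v. \<phi> (pvar v)) m" for m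
    by (simp add: monom_eval_def power)
  thus ?thesis
    by (subst poly_mapping_eq_sum_single)
       (simp add: sum single_eq_pconst_mult assms peval_def)
qed

text \<open>Follows the numbering in \<open>Xgen\<close>: variable 4k + j is the j-th entry of the
  k-th matrix.\<close>

definition coords :: "(nat \<Rightarrow> 'a m2) \<Rightarrow> nat \<Rightarrow> 'a" where
  "coords X v = m2_entries (X (v div 4)) ! (v mod 4)"

lemma m2_map_peval_Xgen: "m2_map (peval (coords X)) (Xgen k) = X k"
proof -
  have "coords X (4 * k + j) = m2_entries (X k) ! j" if "j < 4" for j
    using that by (simp add: coords_def)
  from this[of 0] this[of 1] this[of 2] this[of 3]
  have "coords X (4 * k) = m2_entries (X k) ! 0" "coords X (4 * k + 1) = m2_entries (X k) ! 1"
    "coords X (4 * k + 2) = m2_entries (X k) ! 2" "coords X (4 * k + 3) = m2_entries (X k) ! 3"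
    by simp_all
  hence "m2_map (peval (coords X)) (Xgen k) = M2 (m2_entries (X k) ! 0) (m2_entries (X k) ! 1)
      (m2_entries (X k) ! 2) (m2_entries (X k) ! 3)"
    by (simp only: Xgen_def m2_map.simps peval_pvar)
  thus ?thesis by (cases "X k") simp
qed

lemma peval_cong_rep_vars:
  assumes "poly_in_rep_vars f" "\<And>v. v < 16 \<Longrightarrow> s v = t v"
  shows "peval s f = peval t f"
proof -
  have "monom_eval s m = monom_eval t m" if "m \<in> Poly_Mapping.keys f" for m
  proof -
    have "Poly_Mapping.keys m \<subseteq> {..<16}"
      using assms(1) that by (auto simp: poly_in_rep_vars_def)
    hence "s v = t v" if "v \<in> Poly_Mapping.keys m" for v
      using assms(2) that by blast
    thus ?thesis unfolding monom_eval_def by simp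
  qed
  thus ?thesis by (simp add: peval_def)
qed

lemma peval_rep_ideal:
  assumes "gen_rep p q X" "g \<in> rep_ideal p q"
  shows "peval (coords X) g = 0"
proof -
  let ?ev = "peval (coords X)"
  have gens: "?ev g = 0"
    if "g \<in> {m2_det (Xgen k) - 1 | k. k < 4} \<union>
      {x - y | x y r. r \<in> set (relators p q) \<and>
                (x, y) \<in> set (zip (m2_entries (eval_word Xgen r)) (m2_entries (m2_id :: cpoly m2)))}" for g
    using that
  proof
    assume "g \<in> {m2_det (Xgen k) - 1 | k. k < 4}"
    thus ?thesis
      using assms(1) by (auto simp: peval_diff peval_1 m2_map_peval(4)[symmetric] m2_map_peval_Xgen gen_rep_def)
  next
    assume "g \<in> {x - y | x y r. r \<in> set (relators p q) \<and>
                (x, y) \<in> set (zip (m2_entries (eval_word Xgen r)) (m2_entries (m2_id :: cpoly m2)))}"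
    then obtain x y r where g: "g = x - y" and r: "r \<in> set (relators p q)"
      "(x, y) \<in> set (zip (m2_entries (eval_word Xgen r)) (m2_entries (1 :: cpoly m2)))"
      by auto
    have "m2_map ?ev (eval_word Xgen r) = m2_map ?ev 1"
      using assms(1) r(1) by (simp add: m2_map_peval m2_map_peval_Xgen gen_rep_def)
    thus ?thesis
      using r(2) g by (cases "eval_word Xgen r") (auto simp: m2_one peval_diff)
  qed
  obtain F c where "F \<subseteq> {m2_det (Xgen k) - 1 | k. k < 4} \<union>
      {x - y | x y r. r \<in> set (relators p q) \<and>
                (x, y) \<in> set (zip (m2_entries (eval_word Xgen r)) (m2_entries (m2_id :: cpoly m2)))}"
    "g = (\<Sum>x\<in>F. c x * x)"
    using assms(2) unfolding rep_ideal_def ideal_gen_def by blast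
  thus ?thesis
    using gens by (simp add: peval_sum peval_mult subset_iff)
qed

end

interpretation id_alg: comm_complex_algebra "\<lambda>z. z"
  by unfold_locales auto

interpretation pconst_alg: comm_complex_algebra pconst
  by unfold_locales (rule pconst_add pconst_mult pconst_1)+

section \<open>Polynomials vanishing on a conjugation orbit\<close>

text \<open>Uniqueness of digits in base \<open>N\<close>, for the Kronecker substitution: the
  remainder modulo \<open>N\<close> is the lowest digit, division by \<open>N\<close> shifts the
  rest.\<close>

lemma base_expansion_inject:
  fixes a b :: "nat \<Rightarrow> nat"
  assumes "\<And>v. v < M \<Longrightarrow> a v < N \<and> b v < N" "(\<Sum>v<M. a v * N ^ v) = (\<Sum>v<M. b v * N ^ v)" "v < M"
  shows "a v = b v"
  using assms
proof (induction M arbitrary: a b v)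
  case (Suc M)
  have shift: "(\<Sum>v<Suc M. f v * N ^ v) = f 0 + N * (\<Sum>v<M. f (Suc v) * N ^ v)" for f :: "nat \<Rightarrow> nat"
    unfolding sum.lessThan_Suc_shift by (simp add: sum_distrib_left algebra_simps)
  have lt: "a 0 < N" "b 0 < N"
    using Suc.prems(1)[of 0] by auto
  have eq: "a 0 + N * (\<Sum>v<M. a (Suc v) * N ^ v) = b 0 + N * (\<Sum>v<M. b (Suc v) * N ^ v)"
    using Suc.prems(2) unfolding shift .
  from arg_cong[OF eq, of "\<lambda>x. x mod N"] have 0: "a 0 = b 0"
    using lt by simp
  from arg_cong[OF eq, of "\<lambda>x. x div N"] have "(\<Sum>v<M. a (Suc v) * N ^ v) = (\<Sum>v<M. b (Suc v) * N ^ v)"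
    using lt by simp
  hence "a (Suc v) = b (Suc v)" if "v < M" for v
    using Suc.IH[of "\<lambda>v. a (Suc v)" "\<lambda>v. b (Suc v)" v] Suc.prems(1) that by auto
  thus ?case
    using 0 Suc.prems(3) by (cases v) auto
qed simp

text \<open>Kronecker substitution \<open>x\<^sub>v \<mapsto> z ^ (N ^ v)\<close> with \<open>N\<close> exceeding all exponents
  sends distinct monomials to distinct powers of \<open>z\<close>.\<close>
lemma cpoly_eq_0_if_vanishes:
  assumes "\<And>s. id_alg.peval s f = 0"
  shows "f = 0"
proof (rule ccontr)
  assume "f \<noteq> 0"
  let ?K = "Poly_Mapping.keys f" and ?c = "Poly_Mapping.lookup f"
  define V where "V = (\<Union>m\<in>?K. Poly_Mapping.keys m)"
  define E where "E = (\<Union>m\<in>?K. Poly_Mapping.lookup m ` Poly_Mapping.keys m)"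
  have fin: "finite V" "finite E" by (auto simp: V_def E_def)
  \<comment> \<open>\<open>M\<close> bounds the variables and \<open>N\<close> the exponents;
    inserting 0 also covers variables absent from a monomial.\<close>
  then obtain M N where M: "\<And>v. v \<in> V \<Longrightarrow> v < M" and N: "\<And>k. k \<in> insert 0 E \<Longrightarrow> k < N"
    by (metis finite.insertI finite_nat_set_iff_bounded)
  define e where "e m = (\<Sum>v<M. Poly_Mapping.lookup m v * N ^ v)" for m :: "nat \<Rightarrow>\<^sub>0 nat"
  have keys: "Poly_Mapping.keys m \<subseteq> {..<M}" if "m \<in> ?K" for m
    using M that by (auto simp: V_def)
  have lt: "Poly_Mapping.lookup m v < N" if "m \<in> ?K" for m v
  proof (cases "v \<in> Poly_Mapping.keys m")
    case True
    hence "Poly_Mapping.lookup m v \<in> insert 0 E"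
      using that unfolding E_def by blast
    thus ?thesis by (rule N)
  next
    case False
    thus ?thesis using N[of 0] by (simp add: in_keys_iff)
  qed
  have inj: "m = n" if "m \<in> ?K" "n \<in> ?K" "e m = e n" for m n
  proof (rule poly_mapping_eqI)
    fix v
    show "Poly_Mapping.lookup m v = Poly_Mapping.lookup n v"
    proof (cases "v < M")
      case True
      thus ?thesis
        using base_expansion_inject[of M "Poly_Mapping.lookup m" N "Poly_Mapping.lookup n" v] lt that
        by (simp add: e_def)
    next
      case False
      hence "v \<notin> Poly_Mapping.keys m" "v \<notin> Poly_Mapping.keys n"
        using keys that by blast+
      thus ?thesis by (simp add: in_keys_iff)
    qed
  qed
  define P where "P = (\<Sum>m\<in>?K. Polynomial.monom (?c m) (e m))"
  have "poly P z = 0" for z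
  proof -
    have "monom_eval (\<lambda>v. z ^ (N ^ v)) m = z ^ e m" if "m \<in> ?K" for m
      by (simp add: monom_eval_superset[OF _ keys[OF that]] e_def power_sum mult.commute flip: power_mult)
    hence "id_alg.peval (\<lambda>v. z ^ (N ^ v)) f = poly P z"
      by (simp add: id_alg.peval_def P_def poly_sum poly_monom)
    thus ?thesis using assms by simp
  qed
  hence "P = 0"
    using poly_all_0_iff_0 by blast
  obtain m where m: "m \<in> ?K"
    using \<open>f \<noteq> 0\<close> by (metis keys_eq_empty ex_in_conv)
  \<comment> \<open>As \<open>e\<close> is injective on the monomials of \<open>f\<close>, only
    \<open>m\<close> contributes.\<close>
  have "coeff P (e m) = (\<Sum>n\<in>?K. if n = m then ?c n else 0)"
    unfolding P_def coeff_sum using inj m by (intro sum.cong) auto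
  also have "\<dots> = ?c m"
    using m by simp
  finally show False
    using \<open>P = 0\<close> m by (simp add: in_keys_iff)
qed

lemma monom_eval_scale:
  "monom_eval (\<lambda>v. u * y v) m = u ^ (\<Sum>v\<in>Poly_Mapping.keys m. Poly_Mapping.lookup m v) * monom_eval y m"
  by (simp add: monom_eval_def power_mult_distrib prod.distrib power_sum)

text \<open>\<open>G D G\<^sup>-\<^sup>1 = G D adj(G) / det G\<close>; multiplying by a power of \<open>det G\<close> turns
  \<open>f (G D G\<^sup>-\<^sup>1)\<close> into a polynomial in the entries of \<open>G\<close>.\<close>
definition orbit_poly :: "nat \<Rightarrow> (nat \<Rightarrow> complex m2) \<Rightarrow> cpoly \<Rightarrow> cpoly" where
  "orbit_poly n D f = (\<Sum>m\<in>Poly_Mapping.keys f. pconst (Poly_Mapping.lookup f m)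
     * m2_det (Xgen 0) ^ (n - (\<Sum>v\<in>Poly_Mapping.keys m. Poly_Mapping.lookup m v))
     * monom_eval (pconst_alg.coords (\<lambda>k. Xgen 0 * m2_map pconst (D k) * m2_adj (Xgen 0))) m)"

text \<open>The variables of \<open>Xgen 0\<close> are reused as entries of the conjugating matrix.
  A monomial of degree d absorbs d factors det G as denominators, leaving n - d of them.\<close>

lemma (in comm_complex_algebra) peval_orbit_poly:
  assumes "G * G' = 1" "\<And>k. X k * G = G * m2_map \<iota> (D k)"
    and "\<And>m. m \<in> Poly_Mapping.keys f \<Longrightarrow> (\<Sum>v\<in>Poly_Mapping.keys m. Poly_Mapping.lookup m v) \<le> n"
    and "m2_map (peval s) (Xgen 0) = G"
  shows "peval s (orbit_poly n D f) = m2_det G ^ n * peval (coords X) f"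
proof -
  define u where "u = m2_det G'"
  have u: "m2_det G * u = 1"
    using m2_det_times[of G G'] assms(1) by (simp add: u_def)
  let ?Y = "\<lambda>k. G * m2_map \<iota> (D k) * m2_adj G"
  have X: "X k = sc u * ?Y k" for k
  proof -
    have "X k = sc (u * m2_det G) * X k"
      using u by (simp add: mult.commute sc_1)
    also have "\<dots> = sc u * (X k * (G * m2_adj G))"
      by (simp add: m2_times_adj sc_mult sc_commute[of _ "X k"] mult.assoc)
    also have "\<dots> = sc u * (X k * G * m2_adj G)"
      by (simp only: mult.assoc)
    finally show ?thesis by (simp add: assms(2))
  qed
  have entries: "m2_entries (sc u * A) ! (v mod 4) = u * m2_entries A ! (v mod 4)" for A v
  proof -
    have "v mod 4 = 0 \<or> v mod 4 = 1 \<or> v mod 4 = 2 \<or> v mod 4 = 3"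
      by auto
    thus ?thesis by (cases A) (auto simp: sc_times)
  qed
  have coordsX: "coords X = (\<lambda>v. u * coords ?Y v)"
    unfolding coords_def X entries by simp
  have map_const: "m2_map (peval s) (m2_map pconst A) = m2_map \<iota> A" for A
    by (cases A) (simp add: peval_pconst)
  have "peval s (pconst_alg.coords (\<lambda>k. Xgen 0 * m2_map pconst (D k) * m2_adj (Xgen 0)) v) = coords ?Y v" for v
  proof -
    have "peval s (m2_entries A ! (v mod 4)) = m2_entries (m2_map (peval s) A) ! (v mod 4)" for A
    proof -
      have "v mod 4 = 0 \<or> v mod 4 = 1 \<or> v mod 4 = 2 \<or> v mod 4 = 3"
        by auto
      thus ?thesis by (cases A) auto
    qed
    thus ?thesis
      by (simp add: pconst_alg.coords_def coords_def m2_map_peval map_const assms(4))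
  qed
  hence "peval s (orbit_poly n D f) = (\<Sum>m\<in>Poly_Mapping.keys f. \<iota> (Poly_Mapping.lookup f m)
     * m2_det G ^ (n - (\<Sum>v\<in>Poly_Mapping.keys m. Poly_Mapping.lookup m v)) * monom_eval (coords ?Y) m)"
    unfolding orbit_poly_def peval_sum peval_mult peval_pconst peval_power peval_monom_eval
      m2_map_peval(4)[symmetric] assms(4) by presburger
  also have "\<dots> = (\<Sum>m\<in>Poly_Mapping.keys f. m2_det G ^ n *
      (\<iota> (Poly_Mapping.lookup f m) * monom_eval (coords X) m))"
  proof (rule sum.cong)
    fix m assume m: "m \<in> Poly_Mapping.keys f"
    let ?d = "\<Sum>v\<in>Poly_Mapping.keys m. Poly_Mapping.lookup m v"
    have "m2_det G ^ n * u ^ ?d = m2_det G ^ (n - ?d) * (m2_det G * u) ^ ?d"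
      using assms(3)[OF m] by (simp add: power_mult_distrib flip: power_add mult.assoc)
    hence *: "m2_det G ^ n * u ^ ?d = m2_det G ^ (n - ?d)"
      by (simp add: u)
    show "\<iota> (Poly_Mapping.lookup f m) * m2_det G ^ (n - ?d) * monom_eval (coords ?Y) m
        = m2_det G ^ n * (\<iota> (Poly_Mapping.lookup f m) * monom_eval (coords X) m)"
      unfolding coordsX monom_eval_scale *[symmetric] by (simp add: mult_ac)
  qed simp
  finally show ?thesis
    by (simp add: peval_def sum_distrib_left)
qed

text \<open>For invertible complex g the matrices g D g^-1 form a complex representation, where
  \<open>f\<close> vanishes. So the orbit polynomial times the determinant is the zero polynomial
  and can be evaluated at \<open>G\<close> over the local ring.\<close>

lemma (in local_algebra) vanishes_on_orbit:
  assumes vanish: "\<And>\<rho>. gen_rep p q \<rho> \<Longrightarrow> id_alg.peval (id_alg.coords \<rho>) f = 0"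
    and D: "gen_rep p q D" and f: "poly_in_rep_vars f"
    and G: "\<not> small (m2_det G)" "\<And>k. k < 4 \<Longrightarrow> X k * G = G * m2_map \<iota> (D k)"
  shows "peval (coords X) f = 0"
proof -
  define n where "n = (\<Sum>m\<in>Poly_Mapping.keys f. \<Sum>v\<in>Poly_Mapping.keys m. Poly_Mapping.lookup m v)"
  have n: "(\<Sum>v\<in>Poly_Mapping.keys m. Poly_Mapping.lookup m v) \<le> n" if "m \<in> Poly_Mapping.keys f" for m
    unfolding n_def using that by (intro member_le_sum) auto
  \<comment> \<open>The extra determinant takes care of the singular matrices.\<close>
  have zero: "m2_det (Xgen 0) * orbit_poly n D f = 0"
  proof (rule cpoly_eq_0_if_vanishes)
    fix s
    define g where "g = m2_map (id_alg.peval s) (Xgen 0)"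
    show "id_alg.peval s (m2_det (Xgen 0) * orbit_poly n D f) = 0"
    proof (cases "m2_det g = 0")
      case True
      thus ?thesis
        by (simp add: id_alg.peval_mult g_def id_alg.m2_map_peval(4))
    next
      case False
      define g' where "g' = sc (inverse (m2_det g)) * m2_adj g"
      have g': "g' * g = 1"
        using False by (simp add: g'_def mult.assoc m2_times_adj sc_1 flip: sc_mult)
      hence gg': "g * g' = 1" by (rule m2_left_inverse_imp_right)
      define \<rho> where "\<rho> k = g * D k * g'" for k
      have \<rho>: "\<rho> k * g = g * D k" for k
        by (simp add: \<rho>_def mult.assoc g')
      have det: "m2_det (\<rho> k) = m2_det (D k)" for k
        using \<rho>[of k] False m2_det_times[of "\<rho> k" g] m2_det_times[of g "D k"] by simp
      have "gen_rep p q \<rho>"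
        using gen_rep_conj[OF gg', of \<rho> D] \<rho> det D by (simp add: gen_rep_def)
      hence "id_alg.peval (id_alg.coords \<rho>) f = 0"
        by (rule vanish)
      moreover have "m2_map (\<lambda>z. z) A = A" for A :: "complex m2"
        by (cases A) simp
      hence "id_alg.peval s (orbit_poly n D f) = m2_det g ^ n * id_alg.peval (id_alg.coords \<rho>) f"
        by (intro id_alg.peval_orbit_poly[OF gg' _ n g_def[symmetric]]) (simp_all only: \<rho>)
      ultimately have "id_alg.peval s (orbit_poly n D f) = 0"
        by simp
      thus ?thesis
        by (simp add: id_alg.peval_mult)
    qed
  qed
  obtain G' where G': "G * G' = 1"
    using unit_det_inverse[OF G(1)] .
  \<comment> \<open>\<open>X'\<close> is conjugate to constants at every index and agrees with
    \<open>X\<close> at the four generators, hence in the sixteen variables of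
    \<open>f\<close>.\<close>
  define X' where "X' k = G * m2_map \<iota> (D k) * G'" for k
  have X': "X' k * G = G * m2_map \<iota> (D k)" for k
    using m2_left_inverse_imp_right[OF G'] by (simp add: X'_def mult.assoc)
  have "X' k = X k" if "k < 4" for k
    unfolding X'_def G(2)[OF that, symmetric] by (simp add: mult.assoc G')
  hence X: "peval (coords X) f = peval (coords X') f"
    by (intro peval_cong_rep_vars[OF f]) (simp add: coords_def)
  let ?ev = "peval (coords (\<lambda>_. G))"
  have Xgen: "m2_map ?ev (Xgen 0) = G"
    by (rule m2_map_peval_Xgen)
  have "?ev (m2_det (Xgen 0) * orbit_poly n D f) = 0"
    unfolding zero by (rule peval_0)
  hence "m2_det G * (m2_det G ^ n * peval (coords X) f) = 0"
    by (simp only: peval_mult m2_map_peval(4)[symmetric] Xgen X peval_orbit_poly[OF G' X' n Xgen])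
  hence 0: "m2_det G ^ n * peval (coords X) f = 0"
    by (rule unit_cancel[OF G(1)])
  have "x = 0" if "m2_det G ^ n * x = 0" for n x
    using that by (induction n) (auto simp: mult.assoc dest: unit_cancel[OF G(1)])
  thus ?thesis using 0 by blast
qed

section \<open>Separating an element from an ideal by a local ring\<close>

definition is_ideal :: "'a::comm_ring_1 set \<Rightarrow> bool" where
  "is_ideal J \<longleftrightarrow> 0 \<in> J \<and> (\<forall>x\<in>J. \<forall>y\<in>J. x + y \<in> J) \<and> (\<forall>x\<in>J. \<forall>r. r * x \<in> J)"

lemma is_ideal_ideal_gen: "is_ideal (ideal_gen S)"
  unfolding is_ideal_def
proof (intro conjI ballI allI)
  show "0 \<in> ideal_gen S"
    unfolding ideal_gen_def by (auto intro!: exI[of _ "{}"])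
next
  fix x y assume "x \<in> ideal_gen S" "y \<in> ideal_gen S"
  then obtain F c G d where F: "finite F" "F \<subseteq> S" "x = (\<Sum>s\<in>F. c s * s)"
    and G: "finite G" "G \<subseteq> S" "y = (\<Sum>s\<in>G. d s * s)"
    unfolding ideal_gen_def by blast
  have "x = (\<Sum>s\<in>F \<union> G. (if s \<in> F then c s else 0) * s)"
    unfolding F(3) using F G by (intro sum.mono_neutral_cong_left) auto
  moreover have "y = (\<Sum>s\<in>F \<union> G. (if s \<in> G then d s else 0) * s)"
    unfolding G(3) using F G by (intro sum.mono_neutral_cong_left) auto
  ultimately have "x + y = (\<Sum>s\<in>F \<union> G. ((if s \<in> F then c s else 0) + (if s \<in> G then d s else 0)) * s)"
    by (simp add: sum.distrib distrib_right)
  thus "x + y \<in> ideal_gen S"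
    unfolding ideal_gen_def using F G
    by (intro CollectI exI[of _ "F \<union> G"]
        exI[of _ "\<lambda>s. (if s \<in> F then c s else 0) + (if s \<in> G then d s else 0)"]) auto
next
  fix x r assume "x \<in> ideal_gen S"
  then obtain F c where F: "finite F" "F \<subseteq> S" "x = (\<Sum>s\<in>F. c s * s)"
    unfolding ideal_gen_def by blast
  hence "r * x = (\<Sum>s\<in>F. (r * c s) * s)"
    by (simp add: sum_distrib_left mult.assoc)
  thus "r * x \<in> ideal_gen S"
    unfolding ideal_gen_def using F by (intro CollectI exI[of _ F] exI[of _ "\<lambda>s. r * c s"]) simp
qed

lemma ideal_gen_superset: "x \<in> S \<Longrightarrow> x \<in> ideal_gen S"
  unfolding ideal_gen_def by (intro CollectI exI[of _ "{x}"] exI[of _ "\<lambda>_. 1"]) simp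

definition maximal_avoiding :: "'a::comm_ring_1 \<Rightarrow> 'a set \<Rightarrow> bool" where
  "maximal_avoiding f J \<longleftrightarrow> is_ideal J \<and> f \<notin> J \<and> (\<forall>K. is_ideal K \<and> J \<subset> K \<longrightarrow> f \<in> K)"

text \<open>Zorn's lemma: the union of a nonempty chain of ideals avoiding \<open>f\<close> is again
  one.\<close>

lemma exists_maximal_avoiding:
  assumes "is_ideal I" "f \<notin> I"
  shows "\<exists>J. maximal_avoiding f J \<and> I \<subseteq> J"
proof -
  let ?A = "{J. is_ideal J \<and> f \<notin> J \<and> I \<subseteq> J}"
  have "\<exists>U\<in>?A. \<forall>X\<in>C. X \<subseteq> U" if C: "subset.chain ?A C" for C
  proof (cases "C = {}")
    case True
    thus ?thesis using assms by auto
  next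
    case False
    have J: "is_ideal J \<and> f \<notin> J \<and> I \<subseteq> J" if "J \<in> C" for J
      using C that by (auto simp: subset.chain_def)
    have "is_ideal (\<Union>C)"
      unfolding is_ideal_def
    proof (intro conjI ballI allI)
      show "0 \<in> \<Union>C" using False J by (auto simp: is_ideal_def)
    next
      fix x y assume "x \<in> \<Union>C" "y \<in> \<Union>C"
      then obtain K L where K: "K \<in> C" "x \<in> K" and L: "L \<in> C" "y \<in> L" by blast
      have "K \<subseteq> L \<or> L \<subseteq> K"
        using C K L by (auto simp: subset.chain_def)
      thus "x + y \<in> \<Union>C"
        using K L J[OF K(1)] J[OF L(1)] unfolding is_ideal_def by blast
    next
      fix x r assume "x \<in> \<Union>C"
      thus "r * x \<in> \<Union>C" using J unfolding is_ideal_def by blast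
    qed
    hence "\<Union>C \<in> ?A" using False J by auto
    thus ?thesis by blast
  qed
  then obtain J where J: "J \<in> ?A" "\<forall>X\<in>?A. J \<subseteq> X \<longrightarrow> X = J"
    using subset_Zorn[of ?A] by blast
  hence "maximal_avoiding f J"
    unfolding maximal_avoiding_def by blast
  thus ?thesis using J by blast
qed

section \<open>Non-zero-divisors modulo a maximal avoiding ideal\<close>

locale maximal_avoiding_ideal =
  fixes f :: "'a::comm_ring_1" and J
  assumes maximal: "maximal_avoiding f J"
begin

lemma J_ideal: "0 \<in> J" "x \<in> J \<Longrightarrow> y \<in> J \<Longrightarrow> x + y \<in> J" "x \<in> J \<Longrightarrow> r * x \<in> J"
  using maximal by (simp_all add: maximal_avoiding_def is_ideal_def)

lemma J_ideal': "x \<in> J \<Longrightarrow> x * r \<in> J" "x \<in> J \<Longrightarrow> - x \<in> J" "x \<in> J \<Longrightarrow> y \<in> J \<Longrightarrow> x - y \<in> J"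
  using J_ideal(3)[of x r] J_ideal(3)[of x "- 1"] J_ideal(2)[of x "- y"] J_ideal(3)[of y "- 1"]
  by (simp_all add: mult.commute)

text \<open>The annihilator of the class of \<open>f\<close> modulo \<open>J\<close>, a prime ideal
  at which the quotient by \<open>J\<close> will be localised.\<close>

definition M :: "'a set" where
  "M = {s. s * f \<in> J}"

text \<open>If x were outside \<open>J\<close>, then \<open>J\<close> and x would generate an ideal
  containing \<open>f\<close>, and s x in \<open>J\<close> would put s f in \<open>J\<close>. So
  elements outside \<open>M\<close> are non-zero-divisors modulo \<open>J\<close>.\<close>

lemma cancel:
  assumes "s \<notin> M" "s * x \<in> J"
  shows "x \<in> J"
proof (rule ccontr)
  assume "x \<notin> J"
  let ?K = "{j + r * x | j r. j \<in> J}"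
  have "is_ideal ?K"
    unfolding is_ideal_def
  proof (intro conjI ballI allI)
    show "0 \<in> ?K" using J_ideal(1) by (auto intro!: exI[of _ 0])
  next
    fix a b assume "a \<in> ?K" "b \<in> ?K"
    then obtain j r k t where "a = j + r * x" "b = k + t * x" "j \<in> J" "k \<in> J" by blast
    hence "a + b = (j + k) + (r + t) * x \<and> j + k \<in> J"
      using J_ideal(2) by (simp add: algebra_simps)
    thus "a + b \<in> ?K" by blast
  next
    fix a c assume "a \<in> ?K"
    then obtain j r where "a = j + r * x" "j \<in> J" by blast
    hence "c * a = c * j + (c * r) * x \<and> c * j \<in> J"
      using J_ideal(3) by (simp add: distrib_left mult.assoc)
    thus "c * a \<in> ?K" by blast
  qed
  moreover have "J \<subset> ?K"
  proof
    show "J \<subseteq> ?K" by (force intro: exI[of _ 0])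
    have "x \<in> ?K" using J_ideal(1) by (force intro: exI[of _ 1])
    thus "J \<noteq> ?K" using \<open>x \<notin> J\<close> by blast
  qed
  ultimately have "f \<in> ?K"
    using maximal unfolding maximal_avoiding_def by blast
  then obtain j r where "f = j + r * x" "j \<in> J" by blast
  hence "s * f = s * j + r * (s * x)" "s * j + r * (s * x) \<in> J"
    using assms(2) J_ideal by (simp_all add: distrib_left mult.left_commute)
  thus False using assms(1) by (simp add: M_def)
qed

lemma M_add: "s \<in> M \<Longrightarrow> t \<in> M \<Longrightarrow> s + t \<in> M"
  using J_ideal(2) by (simp add: M_def distrib_right)

lemma M_mult: "s \<in> M \<Longrightarrow> r * s \<in> M" "s \<in> M \<Longrightarrow> s * r \<in> M"
  using J_ideal(3)[of "s * f" r] by (simp_all add: M_def mult_ac)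

lemma not_M_mult: "s \<notin> M \<Longrightarrow> t \<notin> M \<Longrightarrow> s * t \<notin> M"
  using cancel[of s "t * f"] by (auto simp: M_def mult.assoc)

lemma one_not_M: "1 \<notin> M"
  using maximal by (simp add: M_def maximal_avoiding_def)

lemma J_subset_M: "x \<in> J \<Longrightarrow> x \<in> M"
  using J_ideal(3)[of x f] by (simp add: M_def mult.commute)

lemma f_not_J: "f \<notin> J"
  using maximal by (simp add: maximal_avoiding_def)

end

text \<open>\<open>p\<close> and \<open>q\<close> are bound inside so that a pair can be chosen
  without parameters; that \<open>f\<close> lies outside \<open>J\<close> is supplied by
  \<open>maximal_avoiding\<close>.\<close>

definition counterexample :: "cpoly \<Rightarrow> cpoly set \<Rightarrow> bool" where
  "counterexample f J \<longleftrightarrow> (\<exists>p q. (\<forall>i<3. p i \<ge> 1) \<and> euler_number p q \<noteq> 0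
     \<and> \<not> has_exceptional_abelian_character p q \<and> rep_ideal p q \<subseteq> J
     \<and> poly_in_rep_vars f \<and> (\<exists>n. f ^ n \<in> rep_ideal p q))"

text \<open>A quotient type cannot depend on \<open>p\<close> and \<open>q\<close>. So the local ring is formed once and for all
  from a pair chosen to be a counterexample whenever there is one.\<close>
definition chosen :: "cpoly \<times> cpoly set" where
  "chosen = (SOME (f, J). maximal_avoiding f J \<and>
     ((\<exists>f J. maximal_avoiding f J \<and> counterexample f J) \<longrightarrow> counterexample f J))"

lemma chosen:
  "maximal_avoiding (fst chosen) (snd chosen)"
  "maximal_avoiding f J \<Longrightarrow> counterexample f J \<Longrightarrow> counterexample (fst chosen) (snd chosen)"
proof -
  \<comment> \<open>Provides a default pair in case there is no counterexample.\<close>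
  have "is_ideal {0 :: cpoly}" by (simp add: is_ideal_def)
  then obtain J0 where "maximal_avoiding (1::cpoly) J0"
    using exists_maximal_avoiding[of "{0}" 1] by auto
  hence "\<exists>x. case x of (f, J) \<Rightarrow> maximal_avoiding f J \<and>
     ((\<exists>f J. maximal_avoiding f J \<and> counterexample f J) \<longrightarrow> counterexample f J)"
    by (cases "\<exists>f J. maximal_avoiding f J \<and> counterexample f J") auto
  hence "case chosen of (f, J) \<Rightarrow> maximal_avoiding f J \<and>
     ((\<exists>f J. maximal_avoiding f J \<and> counterexample f J) \<longrightarrow> counterexample f J)"
    unfolding chosen_def by (rule someI_ex)
  thus "maximal_avoiding (fst chosen) (snd chosen)"
    "maximal_avoiding f J \<Longrightarrow> counterexample f J \<Longrightarrow> counterexample (fst chosen) (snd chosen)"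
    unfolding case_prod_unfold by blast+
qed

section \<open>The local ring of fractions\<close>

interpretation ch: maximal_avoiding_ideal "fst chosen" "snd chosen"
  by unfold_locales (rule chosen)

text \<open>Equality of fractions over the quotient by \<open>snd chosen\<close>.
  Cross-multiplication suffices because denominators are non-zero-divisors there. Only pairs with
  denominator outside \<open>ch.M\<close> are related to themselves, hence the partial
  quotient.\<close>

definition frac_rel :: "cpoly \<times> cpoly \<Rightarrow> cpoly \<times> cpoly \<Rightarrow> bool" where
  "frac_rel x y \<longleftrightarrow> snd x \<notin> ch.M \<and> snd y \<notin> ch.M \<and> fst x * snd y - fst y * snd x \<in> snd chosen"

lemma frac_rel_refl: "snd x \<notin> ch.M \<Longrightarrow> frac_rel x x"
  by (simp add: frac_rel_def ch.J_ideal)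

lemma frac_rel_eq:
  "snd x \<notin> ch.M \<Longrightarrow> snd y \<notin> ch.M \<Longrightarrow> fst x * snd y = fst y * snd x \<Longrightarrow> frac_rel x y"
  by (simp add: frac_rel_def ch.J_ideal)

quotient_type local_frac = "cpoly \<times> cpoly" / partial: frac_rel
proof (rule part_equivpI)
  show "\<exists>x. frac_rel x x"
    by (intro exI[of _ "(0, 1)"] frac_rel_refl) (simp add: ch.one_not_M)
  show "symp frac_rel"
  proof (rule sympI)
    fix x y assume "frac_rel x y"
    thus "frac_rel y x"
      using ch.J_ideal'(2)[of "fst x * snd y - fst y * snd x"] by (simp add: frac_rel_def)
  qed
  show "transp frac_rel"
  proof (rule transpI)
    fix x y z assume xy: "frac_rel x y" and yz: "frac_rel y z"
    \<comment> \<open>The sum is a multiple of the middle denominator, which lies outside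
      \<open>ch.M\<close> and cancels.\<close>
    have "(fst x * snd y - fst y * snd x) * snd z + (fst y * snd z - fst z * snd y) * snd x \<in> snd chosen"
      using xy yz unfolding frac_rel_def by (intro ch.J_ideal(2) ch.J_ideal'(1)) auto
    hence "snd y * (fst x * snd z - fst z * snd x) \<in> snd chosen"
      by (simp add: algebra_simps)
    thus "frac_rel x z"
      using xy yz ch.cancel by (auto simp: frac_rel_def)
  qed
qed

instantiation local_frac :: comm_ring_1
begin

lift_definition zero_local_frac :: local_frac is "(0, 1)"
  by (rule frac_rel_refl) (simp add: ch.one_not_M)

lift_definition one_local_frac :: local_frac is "(1, 1)"
  by (rule frac_rel_refl) (simp add: ch.one_not_M)

lift_definition plus_local_frac :: "local_frac \<Rightarrow> local_frac \<Rightarrow> local_frac"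
  is "\<lambda>x y. (fst x * snd y + fst y * snd x, snd x * snd y)"
proof -
  fix x x' y y' assume *: "frac_rel x x'" "frac_rel y y'"
  have "(fst x * snd x' - fst x' * snd x) * (snd y * snd y')
      + (fst y * snd y' - fst y' * snd y) * (snd x * snd x') \<in> snd chosen"
    using * unfolding frac_rel_def by (intro ch.J_ideal(2) ch.J_ideal'(1)) auto
  thus "frac_rel (fst x * snd y + fst y * snd x, snd x * snd y)
      (fst x' * snd y' + fst y' * snd x', snd x' * snd y')"
    using * by (simp add: frac_rel_def ch.not_M_mult algebra_simps)
qed

lift_definition times_local_frac :: "local_frac \<Rightarrow> local_frac \<Rightarrow> local_frac"
  is "\<lambda>x y. (fst x * fst y, snd x * snd y)"
proof -
  fix x x' y y' assume *: "frac_rel x x'" "frac_rel y y'"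
  have "(fst x * snd x' - fst x' * snd x) * (fst y * snd y')
      + (fst y * snd y' - fst y' * snd y) * (snd x * fst x') \<in> snd chosen"
    using * unfolding frac_rel_def by (intro ch.J_ideal(2) ch.J_ideal'(1)) auto
  thus "frac_rel (fst x * fst y, snd x * snd y) (fst x' * fst y', snd x' * snd y')"
    using * by (simp add: frac_rel_def ch.not_M_mult algebra_simps)
qed

lift_definition uminus_local_frac :: "local_frac \<Rightarrow> local_frac" is "\<lambda>x. (- fst x, snd x)"
proof -
  fix x x' assume *: "frac_rel x x'"
  hence "- (fst x * snd x' - fst x' * snd x) \<in> snd chosen"
    unfolding frac_rel_def by (intro ch.J_ideal'(2)) auto
  thus "frac_rel (- fst x, snd x) (- fst x', snd x')"
    using * by (simp add: frac_rel_def algebra_simps)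
qed

definition minus_local_frac :: "local_frac \<Rightarrow> local_frac \<Rightarrow> local_frac" where
  "minus_local_frac x y = x + - y"

instance
proof
  fix x y z :: local_frac
  show "x + y + z = x + (y + z)"
    by transfer (rule frac_rel_eq; simp add: frac_rel_def ch.not_M_mult algebra_simps)
  show "x + y = y + x"
    by transfer (rule frac_rel_eq; simp add: frac_rel_def ch.not_M_mult algebra_simps)
  show "0 + x = x"
    by transfer (rule frac_rel_eq; simp add: frac_rel_def)
  show "- x + x = 0"
    by transfer (rule frac_rel_eq; simp add: frac_rel_def ch.not_M_mult ch.one_not_M algebra_simps)
  show "x - y = x + - y"
    by (rule minus_local_frac_def)
  show "x * y * z = x * (y * z)"
    by transfer (rule frac_rel_eq; simp add: frac_rel_def ch.not_M_mult algebra_simps)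
  show "x * y = y * x"
    by transfer (rule frac_rel_eq; simp add: frac_rel_def ch.not_M_mult algebra_simps)
  show "1 * x = x"
    by transfer (rule frac_rel_eq; simp add: frac_rel_def)
  show "(x + y) * z = x * z + y * z"
    by transfer (rule frac_rel_eq; simp add: frac_rel_def ch.not_M_mult algebra_simps)
  show "(0::local_frac) \<noteq> 1"
  proof transfer
    have "- 1 \<notin> snd chosen"
      using ch.one_not_M ch.J_subset_M[of 1] ch.J_ideal'(2)[of "- 1"] by auto
    thus "\<not> frac_rel (0, 1) (1, 1)"
      by (simp add: frac_rel_def)
  qed
qed

end

definition of_cpoly :: "cpoly \<Rightarrow> local_frac" where
  "of_cpoly x = abs_local_frac (x, 1)"

lemma frac_rel_1: "frac_rel (x, 1) (x, 1)"
  by (rule frac_rel_refl) (simp add: ch.one_not_M)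

lemma of_cpoly_add: "of_cpoly (x + y) = of_cpoly x + of_cpoly y"
  by (simp add: of_cpoly_def plus_local_frac.abs_eq frac_rel_1)

lemma of_cpoly_mult: "of_cpoly (x * y) = of_cpoly x * of_cpoly y"
  by (simp add: of_cpoly_def times_local_frac.abs_eq frac_rel_1)

lemma of_cpoly_1: "of_cpoly 1 = 1"
  by (simp add: of_cpoly_def one_local_frac_def)

lemma of_cpoly_eq_0_iff: "of_cpoly x = 0 \<longleftrightarrow> x \<in> snd chosen"
  using Quotient_rel[OF Quotient_local_frac, of "(x, 1)" "(0, 1)"] frac_rel_1
  by (auto simp: of_cpoly_def zero_local_frac_def frac_rel_def)

text \<open>The unit criterion of the localisation; it is independent of the representative because
  \<open>ch.M\<close> is prime and contains the ideal.\<close>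

lift_definition numerator_not_M :: "local_frac \<Rightarrow> bool" is "\<lambda>x. fst x \<notin> ch.M"
proof -
  fix x y assume *: "frac_rel x y"
  have "fst x * snd y - fst y * snd x \<in> ch.M"
    using * ch.J_subset_M by (simp add: frac_rel_def)
  moreover have "a \<in> ch.M \<longleftrightarrow> b \<in> ch.M" if "a - b \<in> ch.M" for a b
    using ch.M_add[OF that, of b] ch.M_add[of a "- 1 * (a - b)"] ch.M_mult(1)[OF that, of "- 1"]
    by auto
  ultimately have "fst x * snd y \<in> ch.M \<longleftrightarrow> fst y * snd x \<in> ch.M"
    by blast
  thus "fst x \<notin> ch.M \<longleftrightarrow> fst y \<notin> ch.M"
    using * ch.not_M_mult ch.M_mult(2) unfolding frac_rel_def by blast
qed

lemma dvd_1_iff_numerator: "x dvd 1 \<longleftrightarrow> numerator_not_M x"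
proof
  assume "x dvd 1"
  then obtain y where "x * y = 1" by (metis dvdE)
  thus "numerator_not_M x"
  proof transfer
    fix x y assume "frac_rel (fst x * fst y, snd x * snd y) (1, 1)"
    hence *: "fst x * fst y - snd x * snd y \<in> ch.M" "snd x * snd y \<notin> ch.M"
      using ch.J_subset_M by (simp_all add: frac_rel_def)
    show "fst x \<notin> ch.M"
    proof
      assume "fst x \<in> ch.M"
      hence "fst x * fst y + - 1 * (fst x * fst y - snd x * snd y) \<in> ch.M"
        using * by (intro ch.M_add ch.M_mult) auto
      thus False using * by simp
    qed
  qed
next
  assume "numerator_not_M x"
  hence "\<exists>y. x * y = 1"
  proof transfer
    fix x assume "frac_rel x x" "fst x \<notin> ch.M"
    thus "\<exists>y\<in>{y. frac_rel y y}. frac_rel (fst x * fst y, snd x * snd y) (1, 1)"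
      by (intro bexI[of _ "(snd x, fst x)"])
         (simp_all add: frac_rel_def ch.not_M_mult ch.one_not_M ch.J_ideal mult.commute)
  qed
  thus "x dvd 1" by (metis dvdI)
qed

text \<open>The non-units are the fractions with numerator in \<open>ch.M\<close>, which is closed
  under sums and multiples.\<close>

interpretation local_frac: local_algebra "\<lambda>c. of_cpoly (pconst c)"
proof unfold_locales
  fix x y :: local_frac
  have "numerator_not_M (x + y) \<Longrightarrow> numerator_not_M x \<or> numerator_not_M y"
    by transfer (metis ch.M_add ch.M_mult(2) fst_conv)
  thus "x + y dvd 1 \<Longrightarrow> x dvd 1 \<or> y dvd 1"
    by (simp add: dvd_1_iff_numerator)
qed (simp_all add: pconst_add pconst_mult pconst_1 of_cpoly_add of_cpoly_mult of_cpoly_1)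

section \<open>Reducedness\<close>

lemma no_counterexample: "\<not> counterexample (fst chosen) (snd chosen)"
proof
  let ?f = "fst chosen" and ?J = "snd chosen"
  assume "counterexample ?f ?J"
  then obtain p q n where p: "\<And>i. i < 3 \<Longrightarrow> p i \<ge> 1" and e: "euler_number p q \<noteq> 0"
    "\<not> has_exceptional_abelian_character p q" and I: "rep_ideal p q \<subseteq> ?J"
    and f: "poly_in_rep_vars ?f" "?f ^ n \<in> rep_ideal p q"
    unfolding counterexample_def by blast
  note map = m2_map_hom[of of_cpoly, OF of_cpoly_add of_cpoly_mult of_cpoly_1]
  \<comment> \<open>The universal representation, read in the local ring.\<close>
  define X where "X = (\<lambda>k. m2_map of_cpoly (Xgen k))"
  have diff: "of_cpoly x = of_cpoly y" if "x - y \<in> rep_ideal p q" for x y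
  proof -
    have "of_cpoly (x - y) = 0"
      using that I of_cpoly_eq_0_iff by blast
    thus ?thesis
      using of_cpoly_add[of "x - y" y] by simp
  qed
  have "gen_rep p q X"
    unfolding gen_rep_def
  proof (intro conjI allI impI ballI)
    fix k :: nat assume "k < 4"
    hence "m2_det (Xgen k) - 1 \<in> rep_ideal p q"
      unfolding rep_ideal_def by (intro ideal_gen_superset) blast
    thus "m2_det (X k) = 1"
      using diff by (simp add: X_def map of_cpoly_1)
  next
    fix r assume r: "r \<in> set (relators p q)"
    have "x - y \<in> rep_ideal p q"
      if "(x, y) \<in> set (zip (m2_entries (eval_word Xgen r)) (m2_entries (m2_id :: cpoly m2)))" for x y
      unfolding rep_ideal_def by (intro ideal_gen_superset) (use r that in blast)
    hence "of_cpoly x = of_cpoly y"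
      if "(x, y) \<in> set (zip (m2_entries (eval_word Xgen r)) (m2_entries (m2_id :: cpoly m2)))" for x y
      using diff that by blast
    hence "m2_map of_cpoly (eval_word Xgen r) = m2_map of_cpoly 1"
      by (cases "eval_word Xgen r") (simp add: m2_one)
    thus "eval_word X r = 1"
      by (simp add: map X_def)
  qed
  then obtain G D where G: "\<not> local_frac.small (m2_det G)"
    "\<And>k. k < 4 \<Longrightarrow> X k * G = G * m2_map (\<lambda>c. of_cpoly (pconst c)) (D k)"
    "gen_rep p q D"
    using local_frac.gen_rep_conj_constant[OF p e] by blast
  \<comment> \<open>A power of f lies in the ideal of the relations and the complex numbers have no
    nilpotents.\<close>
  have "id_alg.peval (id_alg.coords \<rho>) ?f = 0" if "gen_rep p q \<rho>" for \<rho>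
  proof -
    have "id_alg.peval (id_alg.coords \<rho>) ?f ^ n = 0"
      using id_alg.peval_rep_ideal[OF that f(2)] by (simp add: id_alg.peval_power)
    thus ?thesis by simp
  qed
  from local_frac.vanishes_on_orbit[OF this G(3) f(1) G(1,2)]
  have "local_frac.peval (local_frac.coords X) ?f = 0" .
  \<comment> \<open>Evaluation at the universal representation is the canonical map, so the class of
    f in the local ring is zero, although f is not in the ideal.\<close>
  moreover have "local_frac.coords X v = of_cpoly (pvar v)" for v
  proof -
    have "v mod 4 = 0 \<or> v mod 4 = 1 \<or> v mod 4 = 2 \<or> v mod 4 = 3"
      by auto
    moreover have "v mod 4 = Suc 0 \<Longrightarrow> Suc (4 * (v div 4)) = v" "v mod 4 = 2 \<Longrightarrow> Suc (Suc (4 * (v div 4))) = v"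
      "v mod 4 = 3 \<Longrightarrow> 4 * (v div 4) + 3 = v"
      by presburger+
    ultimately show ?thesis
      by (auto simp: local_frac.coords_def X_def Xgen_def)
  qed
  hence "local_frac.coords X = (\<lambda>v. of_cpoly (pvar v))" by blast
  ultimately have "of_cpoly ?f = 0"
    using local_frac.hom_eq_peval[of of_cpoly ?f, OF of_cpoly_add of_cpoly_mult of_cpoly_1] by simp
  thus False
    using of_cpoly_eq_0_iff ch.f_not_J by blast
qed

theorem theorem5p9:
  fixes p q :: "nat \<Rightarrow> int"
  assumes "\<forall>i<3. p i \<ge> 1 \<and> coprime (p i) (q i)"
    and "euler_number p q \<noteq> 0"
    and "\<not> has_exceptional_abelian_character p q"
  shows "character_scheme_reduced p q"
  unfolding character_scheme_reduced_def
proof (intro allI impI)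
  fix f assume f: "invariant_mod (rep_ideal p q) f" "\<exists>n. f ^ n \<in> rep_ideal p q"
  show "f \<in> rep_ideal p q"
  proof (rule ccontr)
    assume "f \<notin> rep_ideal p q"
    moreover have "is_ideal (rep_ideal p q)"
      unfolding rep_ideal_def by (rule is_ideal_ideal_gen)
    \<comment> \<open>Together with \<open>f\<close> this ideal is a counterexample, so the chosen
      pair would be one as well.\<close>
    ultimately obtain J where J: "maximal_avoiding f J" "rep_ideal p q \<subseteq> J"
      using exists_maximal_avoiding by blast
    have "\<forall>i<3. p i \<ge> 1" "poly_in_rep_vars f"
      using assms(1) f(1) by (simp_all add: invariant_mod_def)
    hence "counterexample f J"
      unfolding counterexample_def using assms(2,3) f(2) J(2) by blast
    thus False
      using chosen(2)[OF J(1)] no_counterexample by blast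
  qed
qed

end
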